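(* For every even integer $m\ge 2$ there exists $V_m>\mathrm{vol}(S^{2m})$ such that for every $V\in(0,V_m]$ there is a solution $u:\mathbb{R}^{2m}\to\mathbb{R}$ of $$(-\Delta)^m u=-(2m-1)!\,e^{2mu}\quad\text{in }\mathbb{R}^{2m},\qquad \int_{\mathbb{R}^{2m}}e^{2mu(x)}\,dx=V;$$ that is, there exists a metric on $\mathbb{R}^{2m}$ of the form $g_u=e^{2u}|dx|^2$ satisfying $Q_{g_u}\equiv-(2m-1)!$ and $\mathrm{vol}(g_u)=V$.
   Context: $\Delta$ is the Euclidean Laplacian, $|dx|^2$ the Euclidean metric, $S^{2m}$ the unit round sphere in $\mathbb{R}^{2m+1}$ and $\mathrm{vol}(S^{2m})$ its $2m$-dimensional volume. Solutions are understood in the classical (smooth) sense. For $g_u=e^{2u}|dx|^2$ on $\mathbb{R}^{2m}$, the $Q$-curvature is $Q_{g_u}=e^{-2mu}(-\Delta)^m u$ and $\mathrm{vol}(g_u)=\int_{\mathbb{R}^{2m}}e^{2mu}\,dx$. *)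

theory Defs
  imports "HOL-Analysis.Analysis"
begin

definition partial_deriv :: "'n::finite \<Rightarrow> (real^'n \<Rightarrow> real) \<Rightarrow> real^'n \<Rightarrow> real" where
  "partial_deriv i f = (\<lambda>x. frechet_derivative f (at x) (axis i 1))"

text \<open>
  Frechet differentiability of every iterated partial derivative (the empty list being
  \<open>f\<close> itself) forces their continuity, so this is exactly \<open>C\<^sup>\<infinity>\<close>.
\<close>

definition smooth :: "(real^'n::finite \<Rightarrow> real) \<Rightarrow> bool" where
  "smooth f \<longleftrightarrow> (\<forall>is x. foldr partial_deriv is f differentiable (at x))"

definition laplacian :: "(real^'n::finite \<Rightarrow> real) \<Rightarrow> real^'n \<Rightarrow> real" where
  "laplacian f = (\<lambda>x. \<Sum>i\<in>UNIV. partial_deriv i (partial_deriv i f) x)"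

definition neg_laplacian_pow :: "nat \<Rightarrow> (real^'n::finite \<Rightarrow> real) \<Rightarrow> real^'n \<Rightarrow> real" where
  "neg_laplacian_pow m f = ((\<lambda>g x. - laplacian g x) ^^ m) f"

text \<open>
  \<open>Q\<close>-curvature and volume of the conformal metric \<open>e\<^bsup>2u\<^esup> |dx|\<^sup>2\<close> on \<open>\<real>\<^bsup>2m\<^esup>\<close>; they are meant for
  \<open>CARD('n) = 2 * m\<close>.
\<close>

definition Q_curvature :: "nat \<Rightarrow> (real^'n::finite \<Rightarrow> real) \<Rightarrow> real^'n \<Rightarrow> real" where
  "Q_curvature m u x = exp (- 2 * real m * u x) * neg_laplacian_pow m u x"

definition conformal_volume :: "nat \<Rightarrow> (real^'n::finite \<Rightarrow> real) \<Rightarrow> ennreal" where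
  "conformal_volume m u = (\<integral>\<^sup>+ x. ennreal (exp (2 * real m * u x)) \<partial>lborel)"

text \<open>
  The Riemannian volume element \<open>sqrt (det g)\<close> of the metric that a map from
  \<open>\<real>\<^sup>n\<close> into a Euclidean space pulls back from the ambient inner product.
\<close>

definition volume_density :: "(real^'n::finite \<Rightarrow> 'b::euclidean_space) \<Rightarrow> real^'n \<Rightarrow> real" where
  "volume_density \<phi> x =
     sqrt (det (\<chi> i j. frechet_derivative \<phi> (at x) (axis i 1) \<bullet> frechet_derivative \<phi> (at x) (axis j 1)))"

text \<open>
  Inverse stereographic projection from the north pole. With \<open>CARD('n) = n\<close>, the ambient space
  \<open>\<real>\<^bsup>n+1\<^esup>\<close> is modelled by \<open>(real^'n) \<times> real\<close>, whose inner product is the Euclidean one.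
  It parametrizes the unit sphere minus one point, a null set, so the integral of its volume
  density is the Riemannian volume of the whole round sphere \<open>S\<^sup>n\<close>.
\<close>

definition inv_stereographic :: "real^'n::finite \<Rightarrow> (real^'n) \<times> real" where
  "inv_stereographic x =
     ((2 / (1 + (norm x)\<^sup>2)) *\<^sub>R x, ((norm x)\<^sup>2 - 1) / (1 + (norm x)\<^sup>2))"

definition round_sphere_volume :: "'n::finite itself \<Rightarrow> ennreal" where
  "round_sphere_volume _ =
     (\<integral>\<^sup>+ x. ennreal (volume_density (inv_stereographic :: real^'n \<Rightarrow> _) x) \<partial>lborel)"

lemma inv_stereographic_bij:
  "bij_betw (inv_stereographic :: real^'n::finite \<Rightarrow> _) UNIV (sphere 0 1 - {(0, 1)})"
proof -
  have s: "1 + (norm x)\<^sup>2 > 0" for x :: "real^'n"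
    by (simp add: add_pos_nonneg)
  define \<psi> :: "(real^'n) \<times> real \<Rightarrow> real^'n" where "\<psi> p = (1 / (1 - snd p)) *\<^sub>R fst p" for p
  have l: "\<psi> (inv_stereographic x) = x" for x
  proof -
    have "1 - ((norm x)\<^sup>2 - 1) / (1 + (norm x)\<^sup>2) = 2 / (1 + (norm x)\<^sup>2)"
      using s[of x] by (simp add: field_simps)
    moreover have "(1 + (norm x)\<^sup>2) / 2 * (2 / (1 + (norm x)\<^sup>2)) = 1"
      using s[of x] by (simp add: field_simps)
    ultimately show ?thesis
      by (simp add: \<psi>_def inv_stereographic_def del: times_divide_eq_left times_divide_eq_right)
  qed
  have n1: "inv_stereographic x \<in> sphere 0 1 - {(0, 1)}" for x :: "real^'n"
  proof -
    define t where "t = (norm x)\<^sup>2"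
    have t: "1 + t > 0" using s[of x] by (simp add: t_def)
    have "(norm (inv_stereographic x))\<^sup>2 = (2 / (1 + t))\<^sup>2 * t + ((t - 1) / (1 + t))\<^sup>2"
      by (simp add: inv_stereographic_def norm_Pair power_mult_distrib t_def power_divide)
    also have "\<dots> = (4 * t + (t - 1)\<^sup>2) / (1 + t)\<^sup>2"
      by (simp add: power_divide add_divide_distrib)
    also have "4 * t + (t - 1)\<^sup>2 = (1 + t)\<^sup>2"
      by (simp add: power2_eq_square algebra_simps)
    finally have "(norm (inv_stereographic x))\<^sup>2 = 1" using t by simp
    hence "norm (inv_stereographic x) = 1" by (simp add: power2_eq_1_iff) (smt (verit) norm_ge_zero)
    moreover have "snd (inv_stereographic x) \<noteq> 1"
      using s[of x] by (simp add: inv_stereographic_def field_simps)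
    ultimately show ?thesis by auto
  qed
  have r: "inv_stereographic (\<psi> p) = p" if p: "p \<in> sphere 0 1 - {(0, 1)}" for p
  proof -
    obtain y z where yz: "p = (y, z)" by force
    have n: "(norm y)\<^sup>2 + z\<^sup>2 = 1"
      using p by (simp add: yz norm_Pair real_sqrt_eq_1_iff)
    have z: "z < 1"
    proof (rule ccontr)
      assume "\<not> z < 1"
      hence "z\<^sup>2 \<ge> 1" by (simp add: one_le_power)
      hence "(norm y)\<^sup>2 \<le> 0" using n by linarith
      hence y: "y = 0" by simp
      hence "z\<^sup>2 = 1" using n by simp
      thus False using p \<open>\<not> z < 1\<close> y by (auto simp: yz power2_eq_1_iff)
    qed
    have e: "(norm (\<psi> p))\<^sup>2 = (1 + z) / (1 - z)"
    proof -
      have "(norm (\<psi> p))\<^sup>2 = (1 - z\<^sup>2) / (1 - z)\<^sup>2"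
        using n by (simp add: \<psi>_def yz power_divide)
      also have "1 - z\<^sup>2 = (1 + z) * (1 - z)" by (simp add: power2_eq_square algebra_simps)
      finally show ?thesis using z by (simp add: power2_eq_square)
    qed
    have "1 + (1 + z) / (1 - z) = 2 / (1 - z)" "(1 + z) / (1 - z) - 1 = 2 * z / (1 - z)"
      using z by (auto simp: field_simps)
    thus ?thesis using z by (simp add: inv_stereographic_def e) (simp add: \<psi>_def yz)
  qed
  show ?thesis
    by (rule bij_betwI[where g = \<psi>]) (use l r n1 in auto)
qed

lemma inv_stereographic_has_derivative:
  fixes x :: "real^'n::finite"
  defines "s \<equiv> 1 + (norm x)\<^sup>2"
  shows "(inv_stereographic has_derivative
    (\<lambda>h. ((2 / s) *\<^sub>R h - (4 * (x \<bullet> h) / s\<^sup>2) *\<^sub>R x, 4 * (x \<bullet> h) / s\<^sup>2))) (at x)"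
proof -
  define q where "q = (\<lambda>y :: real^'n. 1 + y \<bullet> y)"
  have q0: "q y \<noteq> 0" for y
    using inner_ge_zero[of y] by (simp add: q_def add_nonneg_eq_0_iff)
  have sq: "s = q x" by (simp add: s_def q_def power2_norm_eq_inner)
  have dq: "(q has_derivative (\<lambda>h. 2 * (x \<bullet> h))) (at x)"
    unfolding q_def by (auto intro!: derivative_eq_intros simp: inner_commute)
  have di: "((\<lambda>y. inverse (q y)) has_derivative (\<lambda>h. - (2 * (x \<bullet> h)) / s\<^sup>2)) (at x)"
    using Deriv.has_derivative_inverse[OF q0 dq]
    by (simp add: sq power2_eq_square divide_inverse mult_ac)
  have d1: "((\<lambda>y. (2 * inverse (q y)) *\<^sub>R y) has_derivative
      (\<lambda>h. (2 / s) *\<^sub>R h - (4 * (x \<bullet> h) / s\<^sup>2) *\<^sub>R x)) (at x)"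
    by (rule has_derivative_eq_rhs[OF has_derivative_scaleR[OF has_derivative_mult_right[OF di] has_derivative_ident]])
      (simp add: sq divide_inverse fun_eq_iff mult_ac)
  have d2: "((\<lambda>y. 1 - 2 * inverse (q y)) has_derivative (\<lambda>h. 4 * (x \<bullet> h) / s\<^sup>2)) (at x)"
    by (rule has_derivative_eq_rhs[OF has_derivative_diff[OF has_derivative_const has_derivative_mult_right[OF di]]])
      (simp add: fun_eq_iff)
  have "inv_stereographic y = ((2 * inverse (q y)) *\<^sub>R y, 1 - 2 * inverse (q y))" for y
    using q0[of y]
    by (simp add: inv_stereographic_def power2_norm_eq_inner q_def divide_inverse[symmetric] field_split_simps)
  hence "inv_stereographic = (\<lambda>y. ((2 * inverse (q y)) *\<^sub>R y, 1 - 2 * inverse (q y)))"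
    by (rule ext)
  thus ?thesis using has_derivative_Pair[OF d1 d2] by simp
qed

lemma volume_density_inv_stereographic:
  fixes x :: "real^'n::finite"
  shows "volume_density inv_stereographic x = (2 / (1 + (norm x)\<^sup>2)) ^ CARD('n)"
proof -
  define s where "s = 1 + (norm x)\<^sup>2"
  have s: "s > 0" by (simp add: s_def add_pos_nonneg)
  let ?D = "frechet_derivative inv_stereographic (at x)"
  have D: "?D = (\<lambda>h. ((2 / s) *\<^sub>R h - (4 * (x \<bullet> h) / s\<^sup>2) *\<^sub>R x, 4 * (x \<bullet> h) / s\<^sup>2))"
    using frechet_derivative_at[OF inv_stereographic_has_derivative[of x]] by (simp add: s_def)
  have xx: "x \<bullet> x = s - 1" by (simp add: s_def power2_norm_eq_inner)
  have g: "?D h \<bullet> ?D k = (2 / s)\<^sup>2 * (h \<bullet> k)" for h k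
  proof -
    have "?D h \<bullet> ?D k = (2 / s)\<^sup>2 * (h \<bullet> k) - 2 * ((2 / s) * (4 / s\<^sup>2) * (x \<bullet> h) * (x \<bullet> k))
        + (4 / s\<^sup>2)\<^sup>2 * (x \<bullet> h) * (x \<bullet> k) * ((s - 1) + 1)"
      by (simp add: D inner_diff_left inner_diff_right xx inner_commute power2_eq_square
          right_diff_distrib left_diff_distrib distrib_left mult_ac diff_divide_distrib)
    also have "(4 / s\<^sup>2)\<^sup>2 * (x \<bullet> h) * (x \<bullet> k) * ((s - 1) + 1) = 2 * ((2 / s) * (4 / s\<^sup>2) * (x \<bullet> h) * (x \<bullet> k))"
      using s by (simp add: power2_eq_square field_simps)
    finally show ?thesis by simp
  qed
  have "det (\<chi> i j. ?D (axis i 1) \<bullet> ?D (axis j 1)) = (\<Prod>i\<in>(UNIV::'n set). (2 / s)\<^sup>2)"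
    by (subst det_diagonal) (auto simp: g inner_axis_axis)
  also have "\<dots> = ((2 / s) ^ CARD('n))\<^sup>2" by (simp flip: power_mult add: mult.commute)
  finally show ?thesis using s by (simp add: volume_density_def s_def[symmetric])
qed

end

theory Submission
  imports Defs
begin

text \<open>
  We look for \<open>u(x) = y(|x|\<^sup>2)\<close>. With \<open>m = k + 1\<close> and \<open>t = |x|\<^sup>2\<close> the Laplacian on \<open>\<real>\<^bsup>2m\<^esup>\<close>
  becomes \<open>4 t h'' + 4 m h'\<close>, and its inverse vanishing at \<open>0\<close> is an explicit integral operator \<open>P\<close>
  that improves regularity up to \<open>t = 0\<close>. For \<open>m\<close> even the equation is
  \<open>y = P\<^sup>k (a - c P e\<^bsup>\<beta> y\<^esup>)\<close> with \<open>c = (2m-1)!\<close>, \<open>\<beta> = 2m\<close>, where \<open>a\<close> is the value of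
  \<open>\<Delta>\<^bsup>m-1\<^esup> u\<close> at the origin, where \<open>u\<close> and the lower iterated Laplacians vanish. Since \<open>y \<le> a P\<^sup>k 1\<close> a priori, the exponential may be
  truncated and a weighted contraction solves the equation globally, continuously in \<open>a\<close>.

  The decreasing function \<open>\<Delta>\<^bsup>m-1\<^esup> u\<close> becomes negative at a radius controlled by \<open>a\<close>, because
  otherwise \<open>y\<close> stays bounded below and \<open>P e\<^bsup>\<beta> y\<^esup>\<close> grows linearly. Hence \<open>y\<close> tends to \<open>-\<infinity>\<close> at least
  linearly in \<open>t\<close>, locally uniformly in \<open>a\<close>, and the volume is finite and continuous in \<open>a\<close>. It tends
  to \<open>0\<close> as \<open>a \<rightarrow> -\<infinity>\<close>. As \<open>a \<rightarrow> \<infinity>\<close> it is unbounded: to bring \<open>\<Delta>\<^bsup>m-1\<^esup> u\<close> down from \<open>a\<close> to \<open>0\<close> one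
  needs \<open>P e\<^bsup>\<beta> y\<^esup> > a/c\<close> somewhere, while little of this comes from a small ball, and outside
  it \<open>P e\<^bsup>\<beta> y\<^esup>\<close> is bounded by the volume. So all positive volumes occur.
\<close>

section \<open>The radial inverse of the Laplacian\<close>

text \<open>For s > 0 the substitution r = s \<tau> gives s^-(k+1) times the integral of r^k f(r)
  over [0,s]. The mean is not normalised: the constant 1 goes to 1/(k+1).\<close>

definition rmean :: "nat \<Rightarrow> (real \<Rightarrow> real) \<Rightarrow> real \<Rightarrow> real" where
  "rmean k f s = integral {0..1} (\<lambda>\<tau>. \<tau> ^ k * f (s * \<tau>))"

text \<open>
  In dimension \<open>2(k+1)\<close>, \<open>h = rpot k f\<close> solves \<open>\<Delta> (h(|x|\<^sup>2)) = f(|x|\<^sup>2)\<close> with \<open>h(0) = 0\<close>: the radial equation is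
  \<open>(t\<^bsup>k+1\<^esup> h')' = t\<^sup>k f / 4\<close>, and scaling the integral of \<open>t\<^sup>k f\<close> to \<open>[0,1]\<close> avoids the division by \<open>t\<^bsup>k+1\<^esup>\<close>.
\<close>

definition rpot :: "nat \<Rightarrow> (real \<Rightarrow> real) \<Rightarrow> real \<Rightarrow> real" where
  "rpot k f t = integral {0..t} (rmean k f) / 4"

lemma has_real_derivative_atLeast_imp_continuous_on:
  fixes f f' :: "real \<Rightarrow> real"
  assumes "\<And>t. t \<ge> a \<Longrightarrow> (f has_real_derivative f' t) (at t within {a..})"
  shows "continuous_on {a..} f"
  using assms DERIV_continuous continuous_on_eq_continuous_within by (metis atLeast_iff)

lemma antitone_on_atLeast:
  fixes f f' :: "real \<Rightarrow> real"
  assumes f: "\<And>t. t \<ge> a \<Longrightarrow> (f has_real_derivative f' t) (at t within {a..})"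
    and f': "\<And>t. t \<ge> a \<Longrightarrow> f' t \<le> 0" and st: "a \<le> s" "s \<le> t"
  shows "f t \<le> f s"
proof (rule DERIV_nonpos_imp_decreasing_open[OF st(2)])
  fix x assume x: "s < x" "x < t"
  hence "(f has_real_derivative f' x) (at x within {a<..})"
    using f[of x] st by (auto intro: DERIV_subset)
  hence "(f has_real_derivative f' x) (at x)"
    using x st by (subst (asm) at_within_open) auto
  thus "\<exists>y. DERIV f x :> y \<and> y \<le> 0" using f' x st by force
next
  show "continuous_on {s..t} f"
    by (rule continuous_on_subset[OF has_real_derivative_atLeast_imp_continuous_on[OF f]])
      (use st in auto)
qed

lemma continuous_on_rmean_integrand:
  assumes "continuous_on {0..} f"
  shows "continuous_on ({0..} \<times> {0..1}) (\<lambda>(s, \<tau>). \<tau> ^ k * f (s * \<tau> :: real) :: real)"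
  unfolding case_prod_beta
  by (intro continuous_intros continuous_on_compose2[OF assms]) auto

lemma rmean_integrable:
  assumes "continuous_on {0..} f" "s \<ge> 0"
  shows "(\<lambda>\<tau>. \<tau> ^ k * f (s * \<tau> :: real) :: real) integrable_on {0..1}"
  by (intro integrable_continuous_real continuous_intros continuous_on_compose2[OF assms(1)])
    (use assms(2) in auto)

lemma continuous_on_rmean:
  assumes "continuous_on {0..} f"
  shows "continuous_on {0..} (rmean k f)"
proof -
  have "continuous_on {0..} (\<lambda>s. integral (cbox 0 1) (\<lambda>\<tau>. \<tau> ^ k * f (s * \<tau>)))"
    by (rule integral_continuous_on_param)
      (use continuous_on_rmean_integrand[OF assms] in simp)
  thus ?thesis by (simp add: rmean_def[abs_def])
qed

text \<open>Differentiating \<open>f (s * \<tau>)\<close> under the integral sign brings down a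
  factor \<tau>, hence the shift from \<open>k\<close> to \<open>Suc k\<close>.\<close>

lemma rmean_has_derivative:
  assumes f: "\<And>t. t \<ge> 0 \<Longrightarrow> (f has_real_derivative f' t) (at t within {0..})"
    and f': "continuous_on {0..} f'" and s: "s \<ge> 0"
  shows "(rmean k f has_real_derivative rmean (Suc k) f' s) (at s within {0..})"
proof -
  have cf: "continuous_on {0..} f"
    by (rule has_real_derivative_atLeast_imp_continuous_on[OF f])
  have "((\<lambda>s. integral (cbox 0 1) (\<lambda>\<tau>. \<tau> ^ k * f (s * \<tau>))) has_field_derivative
      integral (cbox 0 1) (\<lambda>\<tau>. \<tau> ^ Suc k * f' (s * \<tau>))) (at s within {0..})"
  proof (rule leibniz_rule_field_derivative)
    fix x \<tau> :: real assume x: "x \<in> {0..}" and t: "\<tau> \<in> cbox 0 1"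
    have "(f has_real_derivative f' (x * \<tau>)) (at (x * \<tau>) within (\<lambda>x. x * \<tau>) ` {0..})"
      by (rule DERIV_subset[OF f]) (use x t in auto)
    moreover have "((\<lambda>x. x * \<tau>) has_real_derivative \<tau>) (at x within {0..})"
      by (auto intro!: derivative_eq_intros)
    ultimately have "((\<lambda>x. f (x * \<tau>)) has_real_derivative f' (x * \<tau>) * \<tau>) (at x within {0..})"
      by (auto dest: DERIV_image_chain simp: o_def)
    from DERIV_cmult[OF this, of "\<tau> ^ k"]
    show "((\<lambda>x. \<tau> ^ k * f (x * \<tau>)) has_real_derivative \<tau> ^ Suc k * f' (x * \<tau>)) (at x within {0..})"
      by (simp add: mult_ac)
  qed (use rmean_integrable[OF cf] continuous_on_rmean_integrand[OF f'] s in \<open>simp_all del: power_Suc\<close>)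
  thus ?thesis by (simp add: rmean_def[abs_def])
qed

text \<open>This is the product rule for \<tau>^(k+1) f(s \<tau>), integrated over [0,1]. With h' =
  \<open>rmean k f\<close> / 4 it is the radial equation s h'' + (k+1) h' = f/4, obtained without
  any division and therefore valid at s = 0 as well.\<close>

lemma rmean_ode:
  assumes f: "\<And>t. t \<ge> 0 \<Longrightarrow> (f has_real_derivative f' t) (at t within {0..})"
    and f': "continuous_on {0..} f'" and s: "s \<ge> 0"
  shows "s * rmean (Suc k) f' s + real (Suc k) * rmean k f s = f s"
proof -
  have cf: "continuous_on {0..} f"
    by (rule has_real_derivative_atLeast_imp_continuous_on[OF f])
  have "((\<lambda>\<tau>. s * (\<tau> ^ Suc k * f' (s * \<tau>)) + real (Suc k) * (\<tau> ^ k * f (s * \<tau>))) has_integral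
      1 ^ Suc k * f (s * 1) - 0 ^ Suc k * f (s * 0)) {0..1}"
  proof (rule fundamental_theorem_of_calculus)
    fix x :: real assume x: "x \<in> {0..1}"
    have "(f has_real_derivative f' (s * x)) (at (s * x) within (\<lambda>x. s * x) ` {0..1})"
      by (rule DERIV_subset[OF f]) (use x s in auto)
    moreover have "((\<lambda>x. s * x) has_real_derivative s) (at x within {0..1})"
      by (auto intro!: derivative_eq_intros)
    ultimately have "((\<lambda>x. f (s * x)) has_real_derivative f' (s * x) * s) (at x within {0..1})"
      using DERIV_image_chain[where g = "\<lambda>x. s * x" and f = f and x = x and s = "{0..1}"]
      by (simp add: o_def)
    thus "((\<lambda>\<tau>. \<tau> ^ Suc k * f (s * \<tau>)) has_vector_derivative
        s * (x ^ Suc k * f' (s * x)) + real (Suc k) * (x ^ k * f (s * x))) (at x within {0..1})"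
      unfolding has_real_derivative_iff_has_vector_derivative[symmetric]
      by (auto intro!: derivative_eq_intros simp del: power_Suc of_nat_Suc simp: algebra_simps)
  qed simp
  moreover have "((\<lambda>\<tau>. s * (\<tau> ^ Suc k * f' (s * \<tau>)) + real (Suc k) * (\<tau> ^ k * f (s * \<tau>))) has_integral
      s * rmean (Suc k) f' s + real (Suc k) * rmean k f s) {0..1}"
    unfolding rmean_def
    by (intro has_integral_add has_integral_mult_right integrable_integral rmean_integrable cf f' s)
  ultimately show ?thesis by (auto dest: has_integral_unique)
qed

lemma rmean_mono:
  assumes "continuous_on {0..} f" "continuous_on {0..} g" "s \<ge> 0"
    and "\<And>r. 0 \<le> r \<Longrightarrow> r \<le> s \<Longrightarrow> f r \<le> g r"
  shows "rmean k f s \<le> rmean k g s"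
  unfolding rmean_def
proof (intro integral_le rmean_integrable mult_left_mono assms(1-4))
  fix x :: real assume "x \<in> {0..1}"
  thus "0 \<le> s * x" "s * x \<le> s" "0 \<le> x ^ k"
    using assms(3) by (auto intro: mult_left_le)
qed

lemma rmean_linear:
  assumes "continuous_on {0..} f" "continuous_on {0..} g" "s \<ge> 0"
  shows "rmean k (\<lambda>t. a * f t + b * g t) s = a * rmean k f s + b * rmean k g s"
proof -
  have "((\<lambda>\<tau>. a * (\<tau> ^ k * f (s * \<tau>)) + b * (\<tau> ^ k * g (s * \<tau>))) has_integral
      a * rmean k f s + b * rmean k g s) {0..1}"
    unfolding rmean_def
    by (intro has_integral_add has_integral_mult_right integrable_integral rmean_integrable assms)
  thus ?thesis unfolding rmean_def[of _ "\<lambda>t. a * f t + b * g t"]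
    by (intro integral_unique) (simp add: algebra_simps)
qed

lemma rmean_monomial: "rmean k (\<lambda>t. t ^ j) s = s ^ j / real (k + j + 1)"
proof -
  have "((\<lambda>\<tau>. s ^ j * \<tau> ^ (k + j)) has_integral
      s ^ j * 1 ^ (k + j + 1) / real (k + j + 1) - s ^ j * 0 ^ (k + j + 1) / real (k + j + 1)) {0..1}"
    by (rule fundamental_theorem_of_calculus)
      (auto simp flip: has_real_derivative_iff_has_vector_derivative intro!: derivative_eq_intros simp del: power_Suc)
  thus ?thesis unfolding rmean_def
    by (intro integral_unique) (simp add: power_mult_distrib power_add mult_ac)
qed

lemma rmean_cong:
  assumes "\<And>r. r \<ge> 0 \<Longrightarrow> f r = g r" "s \<ge> 0"
  shows "rmean k f s = rmean k g s"
  unfolding rmean_def by (intro integral_cong) (use assms in auto)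

lemma rpot_0 [simp]: "rpot k f 0 = 0"
  by (simp add: rpot_def)

lemma rpot_cong:
  assumes "\<And>r. r \<ge> 0 \<Longrightarrow> f r = g r"
  shows "rpot k f = rpot k g"
  unfolding rpot_def
  by (intro ext arg_cong[where f = "\<lambda>x. x / 4"] integral_cong rmean_cong assms) auto

lemma rmean_integrable_on:
  assumes "continuous_on {0..} f"
  shows "rmean k f integrable_on {0..t}"
  by (rule integrable_continuous_real[OF continuous_on_subset[OF continuous_on_rmean[OF assms]]]) auto

lemma rpot_mono:
  assumes "continuous_on {0..} f" "continuous_on {0..} g"
    and "\<And>r. 0 \<le> r \<Longrightarrow> r \<le> t \<Longrightarrow> f r \<le> g r"
  shows "rpot k f t \<le> rpot k g t"
  unfolding rpot_def using assms
  by (intro divide_right_mono integral_le rmean_integrable_on rmean_mono) auto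

lemma rpot_linear:
  assumes "continuous_on {0..} f" "continuous_on {0..} g"
  shows "rpot k (\<lambda>t. a * f t + b * g t) t = a * rpot k f t + b * rpot k g t"
proof -
  have "((\<lambda>s. a * rmean k f s + b * rmean k g s) has_integral
      a * integral {0..t} (rmean k f) + b * integral {0..t} (rmean k g)) {0..t}"
    by (intro has_integral_add has_integral_mult_right integrable_integral rmean_integrable_on assms)
  hence "(rmean k (\<lambda>t. a * f t + b * g t) has_integral
      a * integral {0..t} (rmean k f) + b * integral {0..t} (rmean k g)) {0..t}"
    by (rule has_integral_eq[rotated]) (simp add: rmean_linear assms)
  thus ?thesis unfolding rpot_def by (simp add: integral_unique add_divide_distrib)
qed

lemma rpot_has_derivative:
  assumes "continuous_on {0..} f" "t \<ge> 0"
  shows "(rpot k f has_real_derivative rmean k f t / 4) (at t within {0..})"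
proof -
  have "((\<lambda>x. integral {0..x} (rmean k f)) has_real_derivative rmean k f t) (at t within {0..t+1})"
    by (rule integral_has_real_derivative)
      (use assms(2) in \<open>auto intro: continuous_on_subset[OF continuous_on_rmean[OF assms(1)]]\<close>)
  moreover have "at t within {0..t+1} = at t within {0..}"
    by (rule at_within_nhd[of _ "{..<t+1}"]) auto
  ultimately show ?thesis
    unfolding rpot_def[abs_def] by (auto intro!: derivative_eq_intros)
qed

lemma continuous_on_rpot:
  assumes "continuous_on {0..} f"
  shows "continuous_on {0..} (rpot k f)"
  by (rule has_real_derivative_atLeast_imp_continuous_on[OF rpot_has_derivative[OF assms]])

lemma continuous_on_funpow_rpot:
  assumes "continuous_on {0..} f"
  shows "continuous_on {0..} ((rpot k ^^ j) f)"
  by (induction j) (auto intro: assms continuous_on_rpot)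

lemma rpot_monomial:
  assumes "t \<ge> 0"
  shows "rpot k (\<lambda>t. t ^ j) t = t ^ Suc j / (4 * real (k + j + 1) * real (Suc j))"
proof -
  have "((\<lambda>s. s ^ j / real (k + j + 1)) has_integral
      t ^ Suc j / (real (k + j + 1) * real (Suc j)) - 0 ^ Suc j / (real (k + j + 1) * real (Suc j))) {0..t}"
    using assms
    by (intro fundamental_theorem_of_calculus)
      (auto simp flip: has_real_derivative_iff_has_vector_derivative intro!: derivative_eq_intros simp del: power_Suc of_nat_Suc of_nat_add)
  hence "integral {0..t} (rmean k (\<lambda>t. t ^ j)) = t ^ Suc j / (real (k + j + 1) * real (Suc j))"
    unfolding rmean_monomial[abs_def] by (subst integral_unique) simp_all
  thus ?thesis unfolding rpot_def by (simp del: power_Suc)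
qed

lemma funpow_rpot_mono:
  assumes "continuous_on {0..} f" "continuous_on {0..} g"
    and "\<And>r. 0 \<le> r \<Longrightarrow> r \<le> t \<Longrightarrow> f r \<le> g r" "0 \<le> s" "s \<le> t"
  shows "(rpot k ^^ j) f s \<le> (rpot k ^^ j) g s"
  using assms(4,5)
proof (induction j arbitrary: s)
  case (Suc j)
  show ?case unfolding funpow.simps o_def
    by (intro rpot_mono continuous_on_funpow_rpot assms Suc.IH) (use Suc.prems in auto)
qed (use assms in auto)

lemma funpow_rpot_linear:
  assumes "continuous_on {0..} f" "continuous_on {0..} g"
  shows "(rpot k ^^ j) (\<lambda>t. a * f t + b * g t) = (\<lambda>t. a * (rpot k ^^ j) f t + b * (rpot k ^^ j) g t)"
  by (induction j) (auto simp: rpot_linear continuous_on_funpow_rpot assms)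

text \<open>One application divides the coefficient of t^j by 4(k+j+1)(j+1) >= 1 while raising the
  power, so the constant never leaves (0,1]. For j = k this is the profile that multiplies
  \<open>a\<close> in a radial solution.\<close>

lemma funpow_rpot_one:
  obtains \<kappa> where "0 < \<kappa>" "\<kappa> \<le> 1" "\<And>t. t \<ge> 0 \<Longrightarrow> (rpot k ^^ j) (\<lambda>_. 1) t = \<kappa> * t ^ j"
proof -
  have "\<exists>\<kappa>>0. \<kappa> \<le> 1 \<and> (\<forall>t\<ge>0. (rpot k ^^ j) (\<lambda>_. 1) t = \<kappa> * t ^ j)"
  proof (induction j)
    case 0
    show ?case by (auto intro!: exI[of _ 1])
  next
    case (Suc j)
    then obtain \<kappa> where \<kappa>: "\<kappa> > 0" "\<kappa> \<le> 1" "\<And>t. t \<ge> 0 \<Longrightarrow> (rpot k ^^ j) (\<lambda>_. 1) t = \<kappa> * t ^ j"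
      by blast
    define D where "D = 4 * real (k + j + 1) * real (Suc j)"
    have D: "D \<ge> 1" unfolding D_def by (simp add: algebra_simps)
    have "(rpot k ^^ Suc j) (\<lambda>_. 1) t = \<kappa> / D * t ^ Suc j" if "t \<ge> 0" for t
    proof -
      \<comment> \<open>The zero summand brings the function into the two-term shape of
        \<open>rpot_linear\<close>.\<close>
      have "(rpot k ^^ Suc j) (\<lambda>_. 1) t = rpot k (\<lambda>t. \<kappa> * t ^ j + 0 * t ^ j) t"
        unfolding funpow.simps o_def by (subst rpot_cong[OF \<kappa>(3)]) auto
      also have "\<dots> = \<kappa> * rpot k (\<lambda>t. t ^ j) t"
        by (subst rpot_linear) (auto intro!: continuous_intros)
      finally show ?thesis using that by (simp add: rpot_monomial D_def del: power_Suc)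
    qed
    thus ?case using \<kappa> D by (intro exI[of _ "\<kappa> / D"]) (auto simp: field_simps simp del: power_Suc)
  qed
  thus ?thesis using that by blast
qed

section \<open>Smooth radial functions\<close>

text \<open>
  Derivatives are taken within \<open>[0,\<infinity>)\<close>: profiles are only evaluated at \<open>|x|\<^sup>2\<close>, and one-sided regularity
  at \<open>0\<close> suffices for smoothness of \<open>f(|x|\<^sup>2)\<close> at the origin.
\<close>

primrec Ck :: "nat \<Rightarrow> (real \<Rightarrow> real) \<Rightarrow> bool" where
  "Ck 0 f \<longleftrightarrow> continuous_on {0..} f"
| "Ck (Suc n) f \<longleftrightarrow> (\<exists>f'. (\<forall>t\<ge>0. (f has_real_derivative f' t) (at t within {0..})) \<and> Ck n f')"

definition Cinf :: "(real \<Rightarrow> real) \<Rightarrow> bool" where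
  "Cinf f \<longleftrightarrow> (\<forall>n. Ck n f)"

lemma Ck_Suc_imp: "Ck (Suc n) f \<Longrightarrow> Ck n f"
proof (induction n arbitrary: f)
  case 0
  thus ?case using has_real_derivative_atLeast_imp_continuous_on by (metis Ck.simps)
next
  case (Suc n)
  thus ?case by (metis Ck.simps(2))
qed

lemma Ck_imp_continuous_on: "Ck n f \<Longrightarrow> continuous_on {0..} f"
  by (induction n) (auto dest: Ck_Suc_imp simp del: Ck.simps(2))

lemma Ck_cong:
  assumes "\<And>t. t \<ge> 0 \<Longrightarrow> f t = g t" "Ck n f"
  shows "Ck n g"
proof (cases n)
  case 0
  thus ?thesis using assms continuous_on_cong[of "{0..}" "{0..}" f g] by simp
next
  case (Suc n')
  have "(g has_real_derivative d) (at t within {0..})"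
    if "(f has_real_derivative d) (at t within {0..})" "t \<ge> 0" for t d
    using that assms(1) unfolding has_field_derivative_def
    by (auto intro: has_derivative_transform[of t "{0..}" g f])
  thus ?thesis using assms(2) Suc by auto
qed

lemma Ck_const: "Ck n (\<lambda>_. c)"
proof (induction n arbitrary: c)
  case (Suc n)
  show ?case by (auto intro!: exI[of _ "\<lambda>_. 0"] Suc)
qed simp

lemma Ck_add: "Ck n f \<Longrightarrow> Ck n g \<Longrightarrow> Ck n (\<lambda>t. f t + g t)"
proof (induction n arbitrary: f g)
  case (Suc n)
  then obtain f' g' where
    "\<And>t. t \<ge> 0 \<Longrightarrow> (f has_real_derivative f' t) (at t within {0..})" "Ck n f'"
    "\<And>t. t \<ge> 0 \<Longrightarrow> (g has_real_derivative g' t) (at t within {0..})" "Ck n g'" by auto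
  thus ?case by (auto intro!: exI[of _ "\<lambda>t. f' t + g' t"] derivative_eq_intros Suc.IH)
qed (auto intro: continuous_intros)

lemma Ck_mult: "Ck n f \<Longrightarrow> Ck n g \<Longrightarrow> Ck n (\<lambda>t. f t * g t)"
proof (induction n arbitrary: f g)
  case (Suc n)
  then obtain f' g' where d:
    "\<And>t. t \<ge> 0 \<Longrightarrow> (f has_real_derivative f' t) (at t within {0..})" "Ck n f'"
    "\<And>t. t \<ge> 0 \<Longrightarrow> (g has_real_derivative g' t) (at t within {0..})" "Ck n g'" by auto
  have "Ck n f" "Ck n g" using Suc.prems Ck_Suc_imp by auto
  hence "Ck n (\<lambda>t. f' t * g t + f t * g' t)" by (intro Ck_add Suc.IH d)
  with d show ?case
    by (auto intro!: exI[of _ "\<lambda>t. f' t * g t + f t * g' t"] derivative_eq_intros)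
qed (auto intro: continuous_intros)

lemma Ck_exp: "Ck n f \<Longrightarrow> Ck n (\<lambda>t. exp (f t))"
proof (induction n arbitrary: f)
  case (Suc n)
  then obtain f' where d:
    "\<And>t. t \<ge> 0 \<Longrightarrow> (f has_real_derivative f' t) (at t within {0..})" "Ck n f'" by auto
  have "Ck n (\<lambda>t. exp (f t) * f' t)"
    using Ck_mult[OF Suc.IH[OF Ck_Suc_imp[OF Suc.prems]] d(2)] .
  moreover have "((\<lambda>t. exp (f t)) has_real_derivative exp (f t) * f' t) (at t within {0..})"
    if "t \<ge> 0" for t
    using d(1)[OF that] by (auto intro!: derivative_eq_intros)
  ultimately show ?case by (auto intro!: exI[of _ "\<lambda>t. exp (f t) * f' t"])
qed (simp add: continuous_on_exp)

text \<open>The induction leaves \<open>k\<close> free because differentiation raises the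
  weight.\<close>

lemma Ck_rmean: "Ck n f \<Longrightarrow> Ck n (rmean k f)"
proof (induction n arbitrary: k f)
  case (Suc n)
  then obtain f' where d:
    "\<And>t. t \<ge> 0 \<Longrightarrow> (f has_real_derivative f' t) (at t within {0..})" "Ck n f'" by auto
  have "Ck n (rmean (Suc k) f')" by (intro Suc.IH d)
  with rmean_has_derivative[OF d(1) Ck_imp_continuous_on[OF d(2)]] show ?case by auto
qed (auto intro: continuous_on_rmean)

lemma Ck_rpot:
  assumes "Ck n f"
  shows "Ck (Suc n) (rpot k f)"
proof -
  have "Ck n (\<lambda>t. (1/4) * rmean k f t)" by (intro Ck_mult Ck_const Ck_rmean assms)
  with rpot_has_derivative[OF Ck_imp_continuous_on[OF assms]] show ?thesis
    by (auto intro!: exI[of _ "\<lambda>t. rmean k f t / 4"])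
qed

text \<open>Each \<open>Ck (Suc n) f\<close> supplies its own derivative. One-sided derivatives on
  [0,\<infinity>) are unique, so these all agree there and a single \<open>f'\<close> serves every
  order.\<close>

lemma Cinf_derivative:
  assumes "Cinf f"
  obtains f' where "\<And>t. t \<ge> 0 \<Longrightarrow> (f has_real_derivative f' t) (at t within {0..})" "Cinf f'"
proof -
  have "Ck (Suc 0) f" using assms unfolding Cinf_def by blast
  then obtain f' where f': "\<And>t. t \<ge> 0 \<Longrightarrow> (f has_real_derivative f' t) (at t within {0..})" by auto
  have "Ck n f'" for n
  proof -
    have "Ck (Suc n) f" using assms unfolding Cinf_def by blast
    then obtain g where g: "\<And>t. t \<ge> 0 \<Longrightarrow> (f has_real_derivative g t) (at t within {0..})" "Ck n g"
      by auto
    have "g t = f' t" if "t \<ge> 0" for t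
    proof (rule has_field_derivative_unique[OF g(1) f'])
      have "at_right t \<le> at t within {0..}" by (rule at_le) (use that in auto)
      thus "at t within {0..} \<noteq> bot"
        using trivial_limit_at_right_real[of t] by (auto simp: bot_unique)
    qed (use that in auto)
    thus ?thesis using Ck_cong g(2) by blast
  qed
  thus thesis using f' that unfolding Cinf_def by blast
qed

text \<open>A class of functions closed under partial derivatives, so all its members are smooth.\<close>

inductive radial_poly :: "(real^'n::finite \<Rightarrow> real) \<Rightarrow> bool" where
  coord: "radial_poly (\<lambda>x. x $ i)"
| radial: "Cinf f \<Longrightarrow> radial_poly (\<lambda>x. f (x \<bullet> x))"
| add: "radial_poly f \<Longrightarrow> radial_poly g \<Longrightarrow> radial_poly (\<lambda>x. f x + g x)"
| mult: "radial_poly f \<Longrightarrow> radial_poly g \<Longrightarrow> radial_poly (\<lambda>x. f x * g x)"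

section \<open>Derivatives and iterated Laplacians of radial functions\<close>

lemma partial_deriv_eq:
  assumes "(f has_derivative D) (at x)"
  shows "partial_deriv i f x = D (axis i 1)"
  unfolding partial_deriv_def using frechet_derivative_at[OF assms] by simp

text \<open>Since |x|^2 only takes values in [0,\<infinity>), the chain rule works with the
  derivative of f within that set, even at the origin, which is sent to its boundary point.\<close>

lemma has_derivative_radial:
  fixes x :: "'a::real_inner"
  assumes "\<And>t. t \<ge> 0 \<Longrightarrow> (f has_real_derivative f' t) (at t within {0..})"
  shows "((\<lambda>x. f (x \<bullet> x)) has_derivative (\<lambda>h. f' (x \<bullet> x) * (2 * (x \<bullet> h)))) (at x)"
proof -
  have "((\<lambda>x::'a. x \<bullet> x) has_derivative (\<lambda>h. 2 * (x \<bullet> h))) (at x)"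
    by (auto intro!: derivative_eq_intros simp: inner_commute)
  from has_derivative_in_compose2[OF _ _ _ this, of "{0..}" f "\<lambda>t. (*) (f' t)"]
  have "((\<lambda>x::'a. f (x \<bullet> x)) has_derivative (\<lambda>h. f' (x \<bullet> x) * (2 * (x \<bullet> h)))) (at x)"
    if "range (\<lambda>x::'a. x \<bullet> x) \<subseteq> {0..}"
    using assms that by (auto simp: has_field_derivative_def)
  thus ?thesis by (simp add: image_subset_iff)
qed

lemma Cinf_const: "Cinf (\<lambda>_. c)"
  unfolding Cinf_def using Ck_const by blast

lemma radial_poly_const: "radial_poly (\<lambda>_. c)"
  using radial[OF Cinf_const] .

lemma radial_poly_has_derivative:
  fixes f :: "real^'n::finite \<Rightarrow> real"
  assumes "radial_poly f"
  shows "\<exists>D. (\<forall>x. (f has_derivative D x) (at x)) \<and> (\<forall>i. radial_poly (\<lambda>x. D x (axis i 1)))"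
  using assms
proof induction
  case (coord j)
  have "((\<lambda>x. x $ j) has_derivative (\<lambda>h. h $ j)) (at x)" for x :: "real^'n"
    by (rule bounded_linear_imp_has_derivative[OF bounded_linear_vec_nth])
  moreover have "radial_poly (\<lambda>x::real^'n. axis i (1::real) $ j)" for i
    by (rule radial_poly_const)
  ultimately show ?case by (intro exI[of _ "\<lambda>_ h. h $ j"]) auto
next
  case (radial f)
  obtain f' where f': "\<And>t. t \<ge> 0 \<Longrightarrow> (f has_real_derivative f' t) (at t within {0..})" "Cinf f'"
    using Cinf_derivative[OF radial] by metis
  have "radial_poly (\<lambda>x::real^'n. f' (x \<bullet> x) * (2 * x $ i))" for i
    by (intro radial_poly.mult radial_poly.radial f' radial_poly.coord radial_poly_const)
  thus ?case
    using has_derivative_radial[OF f'(1)]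
    by (intro exI[of _ "\<lambda>x h. f' (x \<bullet> x) * (2 * (x \<bullet> h))"]) (auto simp: inner_axis)
next
  case (add f g)
  from add.IH obtain D E where
    "(\<forall>x. (f has_derivative D x) (at x)) \<and> (\<forall>i. radial_poly (\<lambda>x. D x (axis i 1)))"
    "(\<forall>x. (g has_derivative E x) (at x)) \<and> (\<forall>i. radial_poly (\<lambda>x. E x (axis i 1)))"
    by (elim exE)
  thus ?case
    by (intro exI[of _ "\<lambda>x h. D x h + E x h"] conjI allI has_derivative_add radial_poly.add) auto
next
  case (mult f g)
  from mult.IH obtain D E where
    "(\<forall>x. (f has_derivative D x) (at x)) \<and> (\<forall>i. radial_poly (\<lambda>x. D x (axis i 1)))"
    "(\<forall>x. (g has_derivative E x) (at x)) \<and> (\<forall>i. radial_poly (\<lambda>x. E x (axis i 1)))"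
    by (elim exE)
  with mult.hyps show ?case
    by (intro exI[of _ "\<lambda>x h. f x * E x h + D x h * g x"] conjI allI has_derivative_mult
        radial_poly.add radial_poly.mult) auto
qed

lemma radial_poly_partial_deriv:
  assumes "radial_poly f"
  shows "radial_poly (partial_deriv i f)"
proof -
  obtain D where D: "\<And>x. (f has_derivative D x) (at x)" "radial_poly (\<lambda>x. D x (axis i 1))"
    using radial_poly_has_derivative[OF assms] by blast
  have "partial_deriv i f = (\<lambda>x. D x (axis i 1))"
    using partial_deriv_eq[OF D(1)] by auto
  thus ?thesis using D(2) by simp
qed

lemma smooth_radial:
  assumes "Cinf f"
  shows "smooth (\<lambda>x :: real^'n::finite. f (x \<bullet> x))"
proof -
  have "radial_poly (foldr partial_deriv is (\<lambda>x :: real^'n. f (x \<bullet> x)))" for "is"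
    by (induction "is") (auto intro: radial_poly_partial_deriv radial_poly.radial assms)
  thus ?thesis
    unfolding smooth_def differentiable_def using radial_poly_has_derivative by blast
qed

lemma laplacian_radial:
  fixes x :: "real^'n::finite"
  assumes h: "\<And>t. t \<ge> 0 \<Longrightarrow> (h has_real_derivative h' t) (at t within {0..})"
    and h': "\<And>t. t \<ge> 0 \<Longrightarrow> (h' has_real_derivative h'' t) (at t within {0..})"
  shows "laplacian (\<lambda>x. h (x \<bullet> x)) x
    = 4 * (x \<bullet> x) * h'' (x \<bullet> x) + 2 * real CARD('n) * h' (x \<bullet> x)"
proof -
  have 1: "partial_deriv i (\<lambda>x. h (x \<bullet> x)) = (\<lambda>x. h' (x \<bullet> x) * (2 * x $ i))" for i :: 'n
    using partial_deriv_eq[OF has_derivative_radial[OF h]] by (auto simp: inner_axis)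
  have 2: "partial_deriv i (\<lambda>x. h' (x \<bullet> x) * (2 * x $ i)) x
      = 4 * h'' (x \<bullet> x) * (x $ i * x $ i) + 2 * h' (x \<bullet> x)" for i :: 'n
  proof -
    have "((\<lambda>x. 2 * x $ i) has_derivative (\<lambda>k. 2 * k $ i)) (at x)"
      by (intro has_derivative_mult_right bounded_linear_imp_has_derivative bounded_linear_vec_nth)
    from partial_deriv_eq[OF has_derivative_mult[OF has_derivative_radial[OF h'] this], of i]
    show ?thesis by (simp add: inner_axis algebra_simps)
  qed
  show ?thesis
    unfolding laplacian_def 1 2
    by (simp add: sum.distrib flip: sum_distrib_left) (simp add: inner_vec_def)
qed

text \<open>In dimension 2(k+1) the radial Laplacian is 4 t h'' + 4(k+1) h', and
  \<open>rmean_ode\<close> collapses it to the source. The constants \<open>b\<close> and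
  \<open>s\<close> allow for the affine profile a - c P e^(\<beta> y).\<close>

lemma laplacian_rpot:
  fixes x :: "real^'n::finite"
  assumes n: "CARD('n) = 2 * Suc k" and f: "Ck 1 f"
  shows "laplacian (\<lambda>x. b + s * rpot k f (x \<bullet> x)) x = s * f (x \<bullet> x)"
proof -
  obtain f' where f': "\<And>t. t \<ge> 0 \<Longrightarrow> (f has_real_derivative f' t) (at t within {0..})" "continuous_on {0..} f'"
    using f by auto
  have h: "((\<lambda>t. b + s * rpot k f t) has_real_derivative s * (rmean k f t / 4)) (at t within {0..})"
    if "t \<ge> 0" for t
    using DERIV_add[OF DERIV_const DERIV_cmult[OF rpot_has_derivative[OF Ck_imp_continuous_on[OF f] that]]]
    by simp
  have h': "((\<lambda>t. s * (rmean k f t / 4)) has_real_derivative s * (rmean (Suc k) f' t / 4)) (at t within {0..})"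
    if "t \<ge> 0" for t
    by (intro DERIV_cmult DERIV_cdivide rmean_has_derivative that f')
  have "laplacian (\<lambda>x. b + s * rpot k f (x \<bullet> x)) x
      = 4 * (x \<bullet> x) * (s * (rmean (Suc k) f' (x \<bullet> x) / 4)) + 2 * real CARD('n) * (s * (rmean k f (x \<bullet> x) / 4))"
    by (rule laplacian_radial[OF h h'])
  also have "\<dots> = s * ((x \<bullet> x) * rmean (Suc k) f' (x \<bullet> x) + real (Suc k) * rmean k f (x \<bullet> x))"
    unfolding n by (simp add: algebra_simps)
  also have "\<dots> = s * f (x \<bullet> x)"
    by (subst rmean_ode[OF f']) auto
  finally show ?thesis .
qed

text \<open>Each negative Laplacian removes one potential and flips the sign of \<open>s\<close>, so
  the induction runs over arbitrary \<open>s\<close>.\<close>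

lemma neg_laplacian_pow_rpot:
  assumes n: "CARD('n::finite) = 2 * Suc k" and f: "Ck 1 f"
  shows "neg_laplacian_pow j (\<lambda>x :: real^'n. s * (rpot k ^^ j) f (x \<bullet> x))
    = (\<lambda>x. (-1) ^ j * s * f (x \<bullet> x))"
proof (induction j arbitrary: s)
  case (Suc j)
  have C: "Ck 1 ((rpot k ^^ j) f)"
    by (induction j) (use f Ck_rpot Ck_Suc_imp in \<open>auto simp del: Ck.simps\<close>)
  have "neg_laplacian_pow (Suc j) (\<lambda>x :: real^'n. s * (rpot k ^^ Suc j) f (x \<bullet> x))
      = neg_laplacian_pow j (\<lambda>x. - laplacian (\<lambda>x. s * (rpot k ^^ Suc j) f (x \<bullet> x)) x)"
    by (simp add: neg_laplacian_pow_def funpow_Suc_right del: funpow.simps)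
  also have "\<dots> = neg_laplacian_pow j (\<lambda>x. (- s) * (rpot k ^^ j) f (x \<bullet> x))"
    by (simp add: laplacian_rpot[OF n C, where b = 0, simplified])
  also have "\<dots> = (\<lambda>x. (-1) ^ Suc j * s * f (x \<bullet> x))"
    using Suc.IH[of "- s"] by simp
  finally show ?case .
qed (simp add: neg_laplacian_pow_def)

section \<open>Existence of radial solutions\<close>

lemma funpow_rpot_nonneg:
  assumes "continuous_on {0..} f" "\<And>t. t \<ge> 0 \<Longrightarrow> f t \<ge> 0" "t \<ge> 0"
  shows "(rpot k ^^ j) f t \<ge> 0"
proof -
  have "rmean k (\<lambda>_. 0) = (\<lambda>_. 0)" by (simp add: rmean_def fun_eq_iff)
  hence "rpot k (\<lambda>_. 0) = (\<lambda>_. 0)" by (simp add: rpot_def[abs_def])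
  hence "(rpot k ^^ j) (\<lambda>_. 0) = (\<lambda>_. 0)" by (induction j) auto
  moreover have "(rpot k ^^ j) (\<lambda>_. 0) t \<le> (rpot k ^^ j) f t"
    by (rule funpow_rpot_mono[of _ _ t]) (use assms in auto)
  ultimately show ?thesis by simp
qed

text \<open>
  In the sup norm weighted by \<open>W = exp (\<integral> L)\<close>, the potential absorbs a Lipschitz constant \<open>L\<close> of any growth and still
  contracts; this gives global existence in one step.
\<close>

lemma exists_weight:
  assumes L: "continuous_on {0..} L" "\<And>t :: real. t \<ge> 0 \<Longrightarrow> L t \<ge> (1 :: real)"
  obtains W where "\<And>t. t \<ge> 0 \<Longrightarrow> W t \<ge> 1"
    and "\<And>t. t \<ge> 0 \<Longrightarrow> (W has_real_derivative L t * W t) (at t within {0..})"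
proof
  let ?W = "\<lambda>t. exp (integral {0..t} L)"
  have i: "L integrable_on {0..t}" for t
    by (rule integrable_continuous_real[OF continuous_on_subset[OF L(1)]]) auto
  show "1 \<le> ?W t" if "t \<ge> 0" for t
    using integral_nonneg[OF i[of t]] L(2) by (force intro: order_trans[of 0 1])
  show "(?W has_real_derivative L t * ?W t) (at t within {0..})" if t: "t \<ge> 0" for t
  proof -
    have "((\<lambda>x. integral {0..x} L) has_real_derivative L t) (at t within {0..t+1})"
      by (rule integral_has_real_derivative) (use t in \<open>auto intro: continuous_on_subset[OF L(1)]\<close>)
    moreover have "at t within {0..t+1} = at t within {0..}"
      by (rule at_within_nhd[of _ "{..<t+1}"]) auto
    ultimately show ?thesis by (auto intro!: derivative_eq_intros)
  qed
qed

lemma rpot_uminus: "continuous_on {0..} f \<Longrightarrow> rpot k (\<lambda>t. - f t) t = - rpot k f t"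
  using rpot_linear[of f "\<lambda>_. 0" k "-1" 0 t] by simp

text \<open>L and W increase, so the mean of f up to s is at most D L(s) W(s), which is the
  derivative of D W. Comparing derivatives gives the upper bound, and the same for -f the lower one.
  The 1/4 in \<open>rpot\<close> becomes the contraction factor.\<close>

lemma abs_rpot_le_weight:
  fixes L W :: "real \<Rightarrow> real"
  assumes W: "\<And>t. t \<ge> 0 \<Longrightarrow> W t \<ge> 1"
      "\<And>t. t \<ge> 0 \<Longrightarrow> (W has_real_derivative L t * W t) (at t within {0..})"
    and L: "mono_on {0..} L" "\<And>t. t \<ge> 0 \<Longrightarrow> L t \<ge> 1"
    and f: "continuous_on {0..} f" "\<And>t. t \<ge> 0 \<Longrightarrow> \<bar>f t\<bar> \<le> D * (L t * W t)"
    and D: "D \<ge> 0" and t: "t \<ge> 0"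
  shows "\<bar>rpot k f t\<bar> \<le> D / 4 * W t"
proof -
  have L0: "L t \<ge> 0" if "t \<ge> 0" for t using L(2)[OF that] by simp
  have W0: "W t \<ge> 0" if "t \<ge> 0" for t using W(1)[OF that] by simp
  have Wmono: "W s \<le> W t" if "0 \<le> s" "s \<le> t" for s t
  proof -
    have "- W t \<le> - W s"
      by (rule antitone_on_atLeast[where f = "\<lambda>t. - W t" and f' = "\<lambda>t. - (L t * W t)" and a = 0])
        (auto intro!: DERIV_minus W that mult_nonneg_nonneg L0 W0)
    thus ?thesis by simp
  qed
  have main: "rpot k h t \<le> D / 4 * W t"
    if h: "continuous_on {0..} h" "\<And>t. t \<ge> 0 \<Longrightarrow> h t \<le> D * (L t * W t)" for h
  proof -
    have m: "rmean k h s \<le> D * (L s * W s)" if s: "s \<ge> 0" for s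
    proof -
      have "h r \<le> D * (L s * W s)" if "0 \<le> r" "r \<le> s" for r
      proof -
        have "L r * W r \<le> L s * W s"
          using that by (intro mult_mono Wmono mono_onD[OF L(1)] L0 W0) auto
        thus ?thesis using h(2)[of r] that D mult_left_mono[of "L r * W r" "L s * W s" D] by linarith
      qed
      hence "rmean k h s \<le> rmean k (\<lambda>t. (D * (L s * W s)) * t ^ 0 + 0 * 1) s"
        by (intro rmean_mono h continuous_intros s) auto
      also have "\<dots> = D * (L s * W s) / real (k + 1)"
        by (subst rmean_linear) (auto intro!: continuous_intros simp: s rmean_monomial[of k 0, simplified])
      also have "\<dots> \<le> D * (L s * W s)"
        using D L0[OF s] W0[OF s] by (intro divide_le_eq_1[THEN iffD2] mult_imp_div_pos_le) (auto simp: mult_le_cancel_left1 field_simps)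
      finally show ?thesis .
    qed
    have "rpot k h t - D / 4 * W t \<le> rpot k h 0 - D / 4 * W 0"
      by (rule antitone_on_atLeast[where f = "\<lambda>t. rpot k h t - D / 4 * W t" and f' = "\<lambda>t. rmean k h t / 4 - D / 4 * (L t * W t)" and a = 0],
          intro DERIV_diff DERIV_cmult rpot_has_derivative h(1) W(2))
        (use m t in auto)
    thus ?thesis using mult_nonneg_nonneg[OF D W0[of 0]] by simp
  qed
  have "rpot k f t \<le> D / 4 * W t" "rpot k (\<lambda>t. - f t) t \<le> D / 4 * W t"
    using f(2) abs_le_iff by (intro main continuous_on_minus f(1); blast)+
  thus ?thesis by (simp add: rpot_uminus f(1) abs_le_iff)
qed

text \<open>Since W <= L W, the bound for one potential has the form required for the next. One
  factor 1/4 is kept and the further ones are dropped.\<close>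

lemma abs_funpow_rpot_le_weight:
  fixes L W :: "real \<Rightarrow> real"
  assumes W: "\<And>t. t \<ge> 0 \<Longrightarrow> W t \<ge> 1"
      "\<And>t. t \<ge> 0 \<Longrightarrow> (W has_real_derivative L t * W t) (at t within {0..})"
    and L: "mono_on {0..} L" "\<And>t. t \<ge> 0 \<Longrightarrow> L t \<ge> 1"
    and f: "continuous_on {0..} f" "\<And>t. t \<ge> 0 \<Longrightarrow> \<bar>f t\<bar> \<le> D * (L t * W t)"
    and D: "D \<ge> 0" and t: "t \<ge> 0"
  shows "\<bar>(rpot k ^^ Suc j) f t\<bar> \<le> D / 4 * W t"
  using t
proof (induction j arbitrary: t)
  case 0
  show ?case using abs_rpot_le_weight[OF W L f D] 0 by simp
next
  case (Suc j)
  have "\<bar>rpot k ((rpot k ^^ Suc j) f) t\<bar> \<le> (D / 4) / 4 * W t"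
  proof (rule abs_rpot_le_weight[OF W L])
    fix t :: real assume t: "t \<ge> 0"
    have "W t \<le> L t * W t" using L(2)[OF t] W(1)[OF t] by simp
    thus "\<bar>(rpot k ^^ Suc j) f t\<bar> \<le> D / 4 * (L t * W t)"
      using Suc.IH[OF t] D mult_left_mono[of "W t" "L t * W t" "D / 4"] by linarith
  qed (use D Suc.prems in \<open>auto intro: continuous_on_rpot continuous_on_funpow_rpot f(1)\<close>)
  moreover have "0 \<le> D * W t" using D W(1)[OF Suc.prems] by simp
  ultimately show ?case by simp
qed

text \<open>The tangent inequality 1 + z <= exp z, taken at z = y - x, stands in for the mean value
  theorem.\<close>

lemma exp_diff_le:
  fixes x y :: real
  assumes "x \<le> M" "y \<le> M"
  shows "\<bar>exp x - exp y\<bar> \<le> exp M * \<bar>x - y\<bar>"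
proof -
  have *: "exp x - exp y \<le> exp M * \<bar>x - y\<bar>" if "x \<le> M" for x y :: real
  proof -
    have "exp x * (1 + (y - x)) \<le> exp x * exp (y - x)"
      by (intro mult_left_mono exp_ge_add_one_self) auto
    hence "exp x - exp y \<le> exp x * (x - y)" by (simp add: exp_diff algebra_simps)
    also have "\<dots> \<le> exp x * \<bar>x - y\<bar>" by (intro mult_left_mono) auto
    also have "\<dots> \<le> exp M * \<bar>x - y\<bar>" using that by (intro mult_right_mono) auto
    finally show ?thesis .
  qed
  show ?thesis using *[OF assms(1), of y] *[OF assms(2), of x] by (auto simp: abs_if)
qed

text \<open>The radial equation integrated m = k + 1 times. The equality is between functions on the
  whole line: \<open>{0..t}\<close> is empty for t < 0, so for k >= 1 it forces y to vanish
  there.\<close>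

definition radial_solution :: "nat \<Rightarrow> real \<Rightarrow> real \<Rightarrow> real \<Rightarrow> (real \<Rightarrow> real) \<Rightarrow> bool" where
  "radial_solution k c \<beta> a y \<longleftrightarrow> continuous_on {0..} y \<and>
     y = (rpot k ^^ k) (\<lambda>t. a - c * rpot k (\<lambda>s. exp (\<beta> * y s)) t)"

lemma continuous_on_rpot_exp:
  "continuous_on {0..} y \<Longrightarrow> continuous_on {0..} (rpot k (\<lambda>s. exp (\<beta> * y s)))"
  by (intro continuous_on_rpot continuous_intros)

text \<open>Capping y at A s^k inside the exponential makes the nonlinearity Lipschitz with a
  constant depending on s alone, so Banach's theorem applies in the weighted norm. One cap serves
  all |a| <= A, which yields the Lipschitz dependence on \<open>a\<close>. The a priori bound then
  removes the cap.\<close>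

lemma radial_solution_exists:
  fixes A c \<beta> :: real
  assumes k: "k \<ge> 1" and c: "c \<ge> 0" and \<beta>: "\<beta> \<ge> 0" and A: "A \<ge> 0"
  obtains y W where "\<And>a. \<bar>a\<bar> \<le> A \<Longrightarrow> radial_solution k c \<beta> a (y a)"
    and "\<And>a b t. \<bar>a\<bar> \<le> A \<Longrightarrow> \<bar>b\<bar> \<le> A \<Longrightarrow> t \<ge> 0 \<Longrightarrow> \<bar>y a t - y b t\<bar> \<le> \<bar>a - b\<bar> * W t"
proof -
  define e where "e s = exp (\<beta> * (A * s ^ k))" for s :: real
  \<comment> \<open>L dominates both the size c e(s) of the capped nonlinearity and its Lipschitz
    constant c \<beta> e(s), and it is at least 1 and increasing, as the weight estimates
    require.\<close>
  define L where "L s = 1 + c * (1 + \<beta>) * e s" for s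
  have e0: "e s \<ge> 0" for s by (simp add: e_def)
  have cL: "continuous_on {0..} L" unfolding L_def e_def by (intro continuous_intros)
  have L1: "L t \<ge> 1" for t using c \<beta> e0 by (simp add: L_def)
  have Lmono: "mono_on {0..} L"
    unfolding L_def e_def using c \<beta> A
    by (intro mono_onI add_left_mono mult_left_mono) (auto intro!: mult_left_mono power_mono)
  have ce: "c * e s \<le> L s" "c * \<beta> * e s \<le> L s" for s
    using c \<beta> e0[of s] by (auto simp: L_def algebra_simps)
  obtain W where W: "\<And>t. t \<ge> 0 \<Longrightarrow> W t \<ge> 1"
      "\<And>t. t \<ge> 0 \<Longrightarrow> (W has_real_derivative L t * W t) (at t within {0..})"
    using exists_weight[OF cL L1] by blast
  have W0: "W t > 0" if "t \<ge> 0" for t using W(1)[OF that] by simp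
  have cW: "continuous_on {0..} W" by (rule has_real_derivative_atLeast_imp_continuous_on[OF W(2)])
  have bound: "\<bar>(rpot k ^^ Suc j) f t\<bar> \<le> D / 4 * W t"
    if "continuous_on {0..} f" "\<And>t. t \<ge> 0 \<Longrightarrow> \<bar>f t\<bar> \<le> D * (L t * W t)" "D \<ge> 0" "t \<ge> 0" for j f D t
    by (rule abs_funpow_rpot_le_weight[OF W Lmono L1 that])
  define E where "E y s = exp (\<beta> * min (y s) (A * s ^ k))" for y :: "real \<Rightarrow> real" and s
  define p where "p = (rpot k ^^ k) (\<lambda>_. 1)"
  define N where "N y = (rpot k ^^ Suc k) (E y)" for y
  define G where "G a y t = a * p t - c * N y t" for a y t
  obtain j where j: "k = Suc j" using k by (cases k) auto
  have cE: "continuous_on {0..} (E y)" if "continuous_on {0..} y" for y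
    unfolding E_def by (intro continuous_intros that)
  have cp: "continuous_on {0..} p" unfolding p_def by (intro continuous_on_funpow_rpot continuous_intros)
  have cN: "continuous_on {0..} (N y)" if "continuous_on {0..} y" for y
    unfolding N_def by (intro continuous_on_funpow_rpot cE that)
  have cG: "continuous_on {0..} (G a y)" if "continuous_on {0..} y" for a y
    unfolding G_def by (intro continuous_intros cp cN that)
  have Geq: "G a y = (rpot k ^^ k) (\<lambda>t. a - c * rpot k (E y) t)" if "continuous_on {0..} y" for a y
  proof -
    have "(rpot k ^^ k) (\<lambda>t. a * 1 + (- c) * rpot k (E y) t)
        = (\<lambda>t. a * p t + (- c) * (rpot k ^^ k) (rpot k (E y)) t)"
      unfolding p_def by (rule funpow_rpot_linear) (intro continuous_intros continuous_on_rpot cE that)+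
    thus ?thesis unfolding G_def N_def funpow_Suc_right o_def by simp
  qed
  have p_bd: "\<bar>p t\<bar> \<le> W t / 4" if "t \<ge> 0" for t
  proof -
    have "\<bar>1\<bar> \<le> 1 * (L t * W t)" if "t \<ge> 0" for t
      using mult_mono[OF L1[of t] W(1)[OF that]] L1[of t] by simp
    from bound[OF continuous_on_const this _ that, of j]
    show ?thesis by (simp add: p_def j)
  qed
  have cN_eq: "c * N y t - d * N z t = (rpot k ^^ Suc k) (\<lambda>s. c * E y s + (- d) * E z s) t"
    if "continuous_on {0..} y" "continuous_on {0..} z" for y z d t
    unfolding N_def by (subst funpow_rpot_linear) (auto intro: cE that)
  have N_bd: "\<bar>c * N y t\<bar> \<le> W t / 4" if y: "continuous_on {0..} y" and t: "t \<ge> 0" for y t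
  proof -
    have "\<bar>(rpot k ^^ Suc k) (\<lambda>s. c * E y s + (- 0) * E y s) t\<bar> \<le> 1 / 4 * W t"
    proof (rule bound)
      fix s :: real assume s: "s \<ge> 0"
      have "c * E y s \<le> c * e s" unfolding E_def e_def using c \<beta> by (auto intro!: mult_left_mono)
      also have "\<dots> \<le> L s" by (rule ce)
      also have "\<dots> \<le> L s * W s" using W(1)[OF s] L1[of s] by simp
      finally show "\<bar>c * E y s + (- 0) * E y s\<bar> \<le> 1 * (L s * W s)"
        using c by (simp add: E_def abs_mult)
    qed (use t in \<open>auto intro!: continuous_intros cE y\<close>)
    thus ?thesis by (subst (asm) cN_eq[symmetric]) (use y in auto)
  qed
  have N_lip: "\<bar>c * N y t - c * N z t\<bar> \<le> d / 4 * W t"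
    if y: "continuous_on {0..} y" and z: "continuous_on {0..} z" and t: "t \<ge> 0"
      and d: "d \<ge> 0" "\<And>s. s \<ge> 0 \<Longrightarrow> \<bar>y s - z s\<bar> \<le> d * W s" for y z d t
    unfolding cN_eq[OF y z]
  proof (rule bound)
    fix s :: real assume s: "s \<ge> 0"
    have "\<bar>E y s - E z s\<bar> \<le> e s * \<bar>\<beta> * min (y s) (A * s ^ k) - \<beta> * min (z s) (A * s ^ k)\<bar>"
      unfolding E_def e_def by (rule exp_diff_le) (use \<beta> in \<open>auto intro!: mult_left_mono\<close>)
    also have "\<dots> = e s * (\<beta> * \<bar>min (y s) (A * s ^ k) - min (z s) (A * s ^ k)\<bar>)"
      using \<beta> by (simp add: abs_mult flip: right_diff_distrib)
    also have "\<dots> \<le> e s * (\<beta> * \<bar>y s - z s\<bar>)"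
      using \<beta> e0[of s] by (intro mult_left_mono) (auto simp: min_def)
    also have "\<dots> \<le> e s * (\<beta> * (d * W s))"
      using \<beta> e0[of s] d(2)[OF s] by (intro mult_left_mono) auto
    finally have "c * \<bar>E y s - E z s\<bar> \<le> c * (e s * (\<beta> * (d * W s)))"
      using c by (rule mult_left_mono)
    also have "\<dots> = (c * \<beta> * e s) * (d * W s)" by (simp add: mult_ac)
    also have "\<dots> \<le> L s * (d * W s)"
      using d(1) W0[OF s] ce(2)[of s] by (intro mult_right_mono) auto
    finally have "c * \<bar>E y s - E z s\<bar> \<le> d * (L s * W s)" by (simp add: mult_ac)
    moreover have "\<bar>c * E y s + (- c) * E z s\<bar> = c * \<bar>E y s - E z s\<bar>"
      using c by (simp add: abs_mult flip: right_diff_distrib)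
    ultimately show "\<bar>c * E y s + (- c) * E z s\<bar> \<le> d * (L s * W s)" by simp
  qed (use t d in \<open>auto intro!: continuous_intros cE y z\<close>)
  \<comment> \<open>A bounded continuous z stands for y/W, so the sup norm of z is the weighted norm
    of y.\<close>
  define Y where "Y z s = W s * apply_bcontfun z s" for z :: "real \<Rightarrow>\<^sub>C real" and s
  have cY: "continuous_on {0..} (Y z)" for z
    unfolding Y_def by (rule continuous_on_mult[OF cW continuous_on_apply_bcontfun])
  \<comment> \<open>Elements of the Banach space live on the whole line while profiles matter only
    on [0,\<infinity>); the absolute value extends them evenly.\<close>
  define \<Psi> where "\<Psi> a z = Bcontfun (\<lambda>t. G a (Y z) \<bar>t\<bar> / W \<bar>t\<bar>)" for a z
  have \<Psi>: "apply_bcontfun (\<Psi> a z) t = G a (Y z) \<bar>t\<bar> / W \<bar>t\<bar>" for a z t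
  proof -
    have "(\<lambda>t. G a (Y z) \<bar>t\<bar> / W \<bar>t\<bar>) \<in> bcontfun"
    proof (rule bcontfun_normI)
      have "W \<bar>t\<bar> \<noteq> 0" for t using W0[of "\<bar>t\<bar>"] by simp
      thus "continuous_on UNIV (\<lambda>t. G a (Y z) \<bar>t\<bar> / W \<bar>t\<bar>)"
        by (intro continuous_intros continuous_on_compose2[OF cG[OF cY]] continuous_on_compose2[OF cW]) auto
      show "norm (G a (Y z) \<bar>t\<bar> / W \<bar>t\<bar>) \<le> \<bar>a\<bar> + 1" for t
      proof -
        have "\<bar>G a (Y z) \<bar>t\<bar>\<bar> \<le> \<bar>a\<bar> * \<bar>p \<bar>t\<bar>\<bar> + \<bar>c * N (Y z) \<bar>t\<bar>\<bar>"
          unfolding G_def by (metis abs_mult abs_triangle_ineq4)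
        also have "\<dots> \<le> \<bar>a\<bar> * (W \<bar>t\<bar> / 4) + W \<bar>t\<bar> / 4"
          by (intro add_mono mult_left_mono p_bd N_bd cY) auto
        also have "\<dots> \<le> (\<bar>a\<bar> + 1) * W \<bar>t\<bar>" using W0[of "\<bar>t\<bar>"] mult_nonneg_nonneg[of "\<bar>a\<bar>" "W \<bar>t\<bar>"]
          unfolding distrib_right by linarith
        finally show ?thesis using W0[of "\<bar>t\<bar>"] by (simp add: divide_le_eq)
      qed
    qed
    thus ?thesis unfolding \<Psi>_def by (simp add: Bcontfun_inverse)
  qed
  have Ydist: "\<bar>Y z s - Y z' s\<bar> \<le> dist z z' * W s" if "s \<ge> 0" for z z' s
  proof -
    have "\<bar>Y z s - Y z' s\<bar> = dist (apply_bcontfun z s) (apply_bcontfun z' s) * W s"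
      using W0[OF that] by (simp add: Y_def dist_real_def abs_mult flip: right_diff_distrib)
    also have "\<dots> \<le> dist z z' * W s"
      using W0[OF that] by (intro mult_right_mono dist_bounded) auto
    finally show ?thesis .
  qed
  have \<Psi>_lip: "dist (\<Psi> a z) (\<Psi> b z') \<le> \<bar>a - b\<bar> / 4 + dist z z' / 4" for a b z z'
  proof (rule dist_bound)
    fix t :: real
    let ?t = "\<bar>t\<bar>"
    have "\<bar>G a (Y z) ?t - G b (Y z') ?t\<bar> = \<bar>(a - b) * p ?t - (c * N (Y z) ?t - c * N (Y z') ?t)\<bar>"
      by (simp add: G_def algebra_simps)
    also have "\<dots> \<le> \<bar>(a - b) * p ?t\<bar> + \<bar>c * N (Y z) ?t - c * N (Y z') ?t\<bar>"
      by (rule abs_triangle_ineq4)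
    also have "\<dots> = \<bar>a - b\<bar> * \<bar>p ?t\<bar> + \<bar>c * N (Y z) ?t - c * N (Y z') ?t\<bar>"
      by (simp add: abs_mult)
    also have "\<dots> \<le> \<bar>a - b\<bar> * (W ?t / 4) + dist z z' / 4 * W ?t"
      by (intro add_mono mult_left_mono p_bd N_lip cY Ydist) auto
    finally show "dist (apply_bcontfun (\<Psi> a z) t) (apply_bcontfun (\<Psi> b z') t) \<le> \<bar>a - b\<bar> / 4 + dist z z' / 4"
      using W0[of ?t] by (simp add: \<Psi> dist_real_def field_simps flip: diff_divide_distrib)
  qed
  have "\<exists>!z. \<Psi> a z = z" for a
    by (rule banach_fix_type[of "1/4"]) (use \<Psi>_lip[of a _ a] in auto)
  then obtain Z where Z: "\<Psi> a (Z a) = Z a" for a by metis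
  have Zdist: "dist (Z a) (Z b) \<le> \<bar>a - b\<bar>" for a b
  proof -
    have *: "d \<le> x" if "d \<le> x / 4 + d / 4" "0 \<le> x" for d x :: real using that by simp
    show ?thesis using \<Psi>_lip[of a "Z a" b "Z b"] unfolding Z by (rule *) simp
  qed
  define y where "y a = G a (Y (Z a))" for a
  have yY: "y a t = Y (Z a) t" if "t \<ge> 0" for a t
    using \<Psi>[of a "Z a" t] that W0[OF that] unfolding Z y_def by (simp add: Y_def)
  \<comment> \<open>The fixed point gives agreement with \<open>Y (Z a)\<close> on [0,\<infinity>)
    only, but potentials see no other values, so \<open>y a\<close> solves the equation on the whole
    line.\<close>
  have yG: "y a = G a (y a)" for a
  proof -
    have "(rpot k ^^ Suc k) (E (Y (Z a))) = (rpot k ^^ Suc k) (E (y a))"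
      unfolding funpow_Suc_right o_def using yY[of _ a]
      by (subst rpot_cong[of "E (Y (Z a))" "E (y a)"]) (auto simp: E_def)
    thus ?thesis unfolding y_def G_def N_def by simp
  qed
  have cy: "continuous_on {0..} (y a)" for a unfolding y_def by (rule cG[OF cY])
  \<comment> \<open>The subtracted term is nonnegative, so y stays below a p and hence below A t^k:
    the cap in \<open>E\<close> is never active.\<close>
  have y_le: "y a t \<le> A * t ^ k" if a: "\<bar>a\<bar> \<le> A" and t: "t \<ge> 0" for a t
  proof -
    obtain \<kappa> where \<kappa>: "0 < \<kappa>" "\<kappa> \<le> 1" "p t = \<kappa> * t ^ k"
      using funpow_rpot_one[of k k] t unfolding p_def by metis
    have "N (y a) t \<ge> 0" unfolding N_def
      by (rule funpow_rpot_nonneg[OF cE[OF cy] _ t]) (simp add: E_def)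
    hence "y a t \<le> a * p t" using c by (subst yG) (simp add: G_def)
    also have "\<dots> \<le> A * (\<kappa> * t ^ k)" unfolding \<kappa>(3) using a \<kappa>(1) t by (intro mult_right_mono) auto
    also have "\<dots> \<le> A * t ^ k" using A \<kappa>(1,2) t by (intro mult_left_mono) (auto intro: mult_left_le_one_le)
    finally show ?thesis .
  qed
  show ?thesis
  proof
    fix a assume a: "\<bar>a\<bar> \<le> A"
    have "rpot k (E (y a)) = rpot k (\<lambda>s. exp (\<beta> * y a s))"
      by (rule rpot_cong) (use y_le[OF a] in \<open>simp add: E_def min_absorb1\<close>)
    thus "radial_solution k c \<beta> a (y a)"
      unfolding radial_solution_def using cy yG[of a] Geq[OF cy[of a], of a] by metis
  next
    fix a b t :: real assume "t \<ge> 0"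
    thus "\<bar>y a t - y b t\<bar> \<le> \<bar>a - b\<bar> * W t"
      using order_trans[OF Ydist mult_right_mono[OF Zdist]] W0[of t] by (simp add: yY)
  qed
qed

section \<open>Decay and total volume\<close>

text \<open>Bootstrapping: if y is C^n, so is its exponential; the potential applied to it gains one
  order and the k outer potentials preserve it.\<close>

lemma Cinf_radial_solution:
  assumes y: "radial_solution k c \<beta> a y"
  shows "Cinf y" "Cinf (\<lambda>s. exp (\<beta> * y s))" "Cinf (\<lambda>t. a - c * rpot k (\<lambda>s. exp (\<beta> * y s)) t)"
proof -
  let ?E = "\<lambda>s. exp (\<beta> * y s)"
  let ?g = "\<lambda>t. a + (- c) * rpot k ?E t"
  have E: "Ck n ?E" if "Ck n y" for n by (intro Ck_exp Ck_mult Ck_const that)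
  have g: "Ck (Suc n) ?g" if "Ck n y" for n
    by (intro Ck_add Ck_mult Ck_const Ck_rpot E that)
  have it: "Ck n ((rpot k ^^ j) f)" if "Ck n f" for n j f
    by (induction j) (use that Ck_rpot Ck_Suc_imp in \<open>auto simp del: Ck.simps\<close>)
  have y_eq: "y = (rpot k ^^ k) ?g" using y by (simp add: radial_solution_def)
  have Ck: "Ck n y" for n
  proof (induction n)
    case 0
    show ?case using y by (simp add: radial_solution_def)
  next
    case (Suc n)
    show ?case by (subst y_eq) (rule it[OF g[OF Suc]])
  qed
  show "Cinf y" "Cinf ?E" unfolding Cinf_def using Ck E by blast+
  show "Cinf (\<lambda>t. a - c * rpot k ?E t)"
    using Ck_Suc_imp[OF g[OF Ck]] unfolding Cinf_def by simp
qed

text \<open>The first k negative Laplacians strip off the k outer potentials with sign (-1)^k; the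
  last one kills the constant \<open>a\<close> and undoes the inner potential.\<close>

lemma radial_solution_pde:
  fixes x :: "real^'n::finite"
  assumes y: "radial_solution k c \<beta> a y" and n: "CARD('n) = 2 * Suc k"
  shows "neg_laplacian_pow (Suc k) (\<lambda>x :: real^'n. y (x \<bullet> x)) x
    = (-1) ^ k * c * exp (\<beta> * y (x \<bullet> x))"
proof -
  let ?E = "\<lambda>s. exp (\<beta> * y s)"
  let ?g = "\<lambda>t. a - c * rpot k ?E t"
  have y_eq: "y = (rpot k ^^ k) ?g" using y by (simp add: radial_solution_def)
  have C: "Ck 1 ?g" "Ck 1 ?E" using Cinf_radial_solution[OF y] unfolding Cinf_def by blast+
  have "neg_laplacian_pow k (\<lambda>x :: real^'n. 1 * (rpot k ^^ k) ?g (x \<bullet> x)) = (\<lambda>x. (-1) ^ k * 1 * ?g (x \<bullet> x))"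
    by (rule neg_laplacian_pow_rpot[OF n C(1)])
  hence *: "neg_laplacian_pow k (\<lambda>x :: real^'n. y (x \<bullet> x))
      = (\<lambda>x. (-1) ^ k * a + (- ((-1) ^ k * c)) * rpot k ?E (x \<bullet> x))"
    by (simp flip: y_eq add: algebra_simps)
  have "neg_laplacian_pow (Suc k) (\<lambda>x :: real^'n. y (x \<bullet> x)) x
      = - laplacian (neg_laplacian_pow k (\<lambda>x :: real^'n. y (x \<bullet> x))) x"
    by (simp add: neg_laplacian_pow_def)
  also have "\<dots> = (-1) ^ k * c * exp (\<beta> * y (x \<bullet> x))"
    unfolding * by (subst laplacian_rpot[OF n C(2)]) simp
  finally show ?thesis .
qed

lemma rpot_const: "t \<ge> 0 \<Longrightarrow> rpot k (\<lambda>_. b) t = b * t / (4 * real (k + 1))"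
  using rpot_linear[of "\<lambda>_. 1" "\<lambda>_. 1" k b 0 t] rpot_monomial[of t k 0] by simp

text \<open>The potential of the exponential is nonnegative, so the source is at most
  \<open>a\<close>, and potentials preserve inequalities.\<close>

lemma radial_solution_le:
  assumes y: "radial_solution k c \<beta> a y" and c: "c \<ge> 0" and t: "t \<ge> 0"
  shows "y t \<le> a * (rpot k ^^ k) (\<lambda>_. 1) t"
proof -
  let ?g = "\<lambda>t. a - c * rpot k (\<lambda>s. exp (\<beta> * y s)) t"
  have cy: "continuous_on {0..} y" and y_eq: "y = (rpot k ^^ k) ?g"
    using y by (auto simp: radial_solution_def)
  have "(rpot k ^^ k) ?g t \<le> (rpot k ^^ k) (\<lambda>t. a * 1 + 0 * 1) t"
  proof (rule funpow_rpot_mono[of _ _ t])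
    fix r :: real assume "0 \<le> r"
    moreover have "continuous_on {0..} (\<lambda>s. exp (\<beta> * y s))" by (intro continuous_intros cy)
    ultimately have "rpot k (\<lambda>s. exp (\<beta> * y s)) r \<ge> 0"
      using funpow_rpot_nonneg[of "\<lambda>s. exp (\<beta> * y s)" r 1 k] by simp
    thus "?g r \<le> a * 1 + 0 * 1" using c by simp
  qed (use t in \<open>auto intro!: continuous_intros continuous_on_rpot_exp cy\<close>)
  also have "\<dots> = a * (rpot k ^^ k) (\<lambda>_. 1) t"
    by (subst funpow_rpot_linear) auto
  finally show ?thesis using y_eq by metis
qed

text \<open>In the next two lemmas \<open>a - c * rpot k \<dots>\<close> is the profile of \<open>\<Delta>\<^bsup>m-1\<^esup> u\<close>.\<close>

lemma radial_top_antitone: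
  assumes y: "continuous_on {0..} y" and c: "c \<ge> 0" and st: "0 \<le> s" "s \<le> t"
  shows "a - c * rpot k (\<lambda>s. exp (\<beta> * y s)) t \<le> a - c * rpot k (\<lambda>s. exp (\<beta> * y s)) s"
proof (rule antitone_on_atLeast[where f = "\<lambda>t. a - c * rpot k (\<lambda>s. exp (\<beta> * y s)) t" and a = 0])
  let ?E = "\<lambda>s. exp (\<beta> * y s)"
  have cE: "continuous_on {0..} ?E" by (intro continuous_intros y)
  show "((\<lambda>t. a - c * rpot k ?E t) has_real_derivative 0 - c * (rmean k ?E t / 4)) (at t within {0..})"
    if "t \<ge> 0" for t
    by (intro DERIV_diff DERIV_const DERIV_cmult rpot_has_derivative cE that)
  show "0 - c * (rmean k ?E t / 4) \<le> 0" if t: "t \<ge> 0" for t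
  proof -
    have "rmean k (\<lambda>_. 0) t \<le> rmean k ?E t" by (rule rmean_mono) (use cE t in auto)
    thus ?thesis using c by (simp add: rmean_def)
  qed
qed (use st in auto)

lemma radial_top_neg:
  assumes y: "radial_solution k c \<beta> a y" and c: "c > 0" and \<beta>: "\<beta> \<ge> 0"
    and R: "R \<ge> 1" "R \<ge> 4 * real (k + 1) * (A + 1) * exp \<beta> / c" and a: "a \<le> A"
  shows "a - c * rpot k (\<lambda>s. exp (\<beta> * y s)) R \<le> - (1 / R ^ k)"
proof (rule ccontr)
  let ?g = "\<lambda>t. a - c * rpot k (\<lambda>s. exp (\<beta> * y s)) t"
  have cy: "continuous_on {0..} y" and y_eq: "y = (rpot k ^^ k) ?g"
    using y by (auto simp: radial_solution_def)
  have cE: "continuous_on {0..} (\<lambda>s. exp (\<beta> * y s))" by (intro continuous_intros cy)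
  assume "\<not> ?g R \<le> - (1 / R ^ k)"
  hence gR: "?g R \<ge> - (1 / R ^ k)" by simp
  \<comment> \<open>By monotonicity the profile is at least -1/R^k on all of [0,R]. Applying k
    potentials gives y >= -\<kappa> (r/R)^k, which is at least -1.\<close>
  have y0: "y r \<ge> - 1" if r: "0 \<le> r" "r \<le> R" for r
  proof -
    obtain \<kappa> where \<kappa>: "0 < \<kappa>" "\<kappa> \<le> 1" "(rpot k ^^ k) (\<lambda>_. 1) r = \<kappa> * r ^ k"
      using funpow_rpot_one[of k k] r by metis
    have "(rpot k ^^ k) (\<lambda>_. (- (1 / R ^ k)) * 1 + 0 * 1) r \<le> (rpot k ^^ k) ?g r"
    proof (rule funpow_rpot_mono[of _ _ R])
      show "(- (1 / R ^ k)) * 1 + 0 * 1 \<le> ?g s" if "0 \<le> s" "s \<le> R" for s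
        using radial_top_antitone[OF cy less_imp_le[OF c] that, of a k \<beta>] gR by linarith
    qed (use r in \<open>auto intro!: continuous_intros continuous_on_rpot_exp cy\<close>)
    also have "(rpot k ^^ k) (\<lambda>_. (- (1 / R ^ k)) * 1 + 0 * 1) r = (- (1 / R ^ k)) * (\<kappa> * r ^ k)"
      by (subst funpow_rpot_linear) (auto simp: \<kappa>(3))
    finally have "- (\<kappa> * r ^ k / R ^ k) \<le> y r" using y_eq by simp
    moreover have "\<kappa> * r ^ k \<le> 1 * R ^ k"
      using \<kappa> r by (intro mult_mono power_mono) auto
    hence "\<kappa> * r ^ k / R ^ k \<le> 1" using R(1) by (simp add: divide_le_eq)
    ultimately show ?thesis by linarith
  qed
  \<comment> \<open>With y >= -1 the potential of the exponential at R is at least e^(-\<beta>) R /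
    (4(k+1)). The lower bound on R makes c times this at least A + 1, which pushes the profile down
    to -1 or below.\<close>
  have "rpot k (\<lambda>_. exp (- \<beta>)) R \<le> rpot k (\<lambda>s. exp (\<beta> * y s)) R"
  proof (rule rpot_mono)
    show "exp (- \<beta>) \<le> exp (\<beta> * y r)" if "0 \<le> r" "r \<le> R" for r
      using mult_left_mono[OF y0[OF that] \<beta>] by simp
  qed (use cE in auto)
  hence "c * (exp (- \<beta>) * R / (4 * real (k + 1))) \<le> c * rpot k (\<lambda>s. exp (\<beta> * y s)) R"
    using c R(1) rpot_const[of R k "exp (- \<beta>)"] by (intro mult_left_mono) auto
  moreover have "A + 1 \<le> c * (exp (- \<beta>) * R / (4 * real (k + 1)))"
    using R(2) c by (simp add: field_simps exp_minus del: of_nat_add of_nat_Suc)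
  moreover have "1 / R ^ k \<le> 1" using R(1) by (simp add: one_le_power)
  ultimately show False using a \<open>\<not> ?g R \<le> - (1 / R ^ k)\<close> by linarith
qed

text \<open>The stretch where g may be positive contributes only O(1/s) to the mean at s, so the
  mean is eventually below a negative constant and the potential falls linearly. \<open>C\<close>
  and \<open>\<epsilon>\<close> are chosen before \<open>g\<close>: they depend on the bounds
  alone.\<close>

lemma rpot_linear_decay:
  assumes k: "k \<ge> 1" and \<delta>: "\<delta> > 0" and A: "A \<ge> 0" and R: "R \<ge> 0"
  shows "\<exists>C \<epsilon>. \<epsilon> > 0 \<and> (\<forall>g. continuous_on {0..} g \<longrightarrow> (\<forall>t\<ge>0. g t \<le> A) \<longrightarrow> (\<forall>t\<ge>R. g t \<le> - \<delta>) \<longrightarrow>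
    (\<forall>t\<ge>0. rpot k g t \<le> C - \<epsilon> * t))"
proof -
  \<comment> \<open>From S on the error (A + \<delta>) R / s is at most half of the main term
    \<delta>/(k+1). What remains is 4 \<epsilon>, and the 4 is absorbed by the 1/4 in the potential.
    The summand 1 keeps S positive.\<close>
  define S where "S = 2 * real (k + 1) * ((A + \<delta>) * R) / \<delta> + 1"
  define \<epsilon> where "\<epsilon> = \<delta> / (8 * real (k + 1))"
  have S: "S > 0" unfolding S_def using \<delta> A R by (intro add_nonneg_pos) auto
  have \<epsilon>: "\<epsilon> > 0" unfolding \<epsilon>_def using \<delta> by simp
  have "rpot k g t \<le> (A * S + \<epsilon> * S) - \<epsilon> * t"
    if g: "continuous_on {0..} g" "\<And>t. t \<ge> 0 \<Longrightarrow> g t \<le> A" "\<And>t. t \<ge> R \<Longrightarrow> g t \<le> - \<delta>" and t: "t \<ge> 0" for g t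
  proof -
    have small: "rpot k g t + \<epsilon> * t \<le> A * S + \<epsilon> * S" if t: "0 \<le> t" "t \<le> S" for t
    proof -
      have "rpot k g t \<le> rpot k (\<lambda>_. A) t" by (rule rpot_mono) (use g in auto)
      also have "\<dots> = A * t / (4 * real (k + 1))" by (rule rpot_const[OF t(1)])
      also have "\<dots> \<le> A * t / 1" using A t by (intro divide_left_mono) auto
      also have "\<dots> \<le> A * S" using A t by (simp add: mult_left_mono)
      finally show ?thesis using \<epsilon> t by (intro add_mono mult_left_mono) auto
    qed
    have m: "rmean k g s \<le> - (4 * \<epsilon>)" if s: "s \<ge> S" for s
    proof -
      have s0: "s > 0" using s S by simp
      \<comment> \<open>Where s \<tau> < R, the excess over -\<delta> \<tau>^k is at most (A +
        \<delta>) \<tau>^k, and k >= 1 gives \<tau>^k <= \<tau> <= R/s.\<close>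
      have "rmean k g s \<le> integral {0..1} (\<lambda>\<tau>. (- \<delta>) * \<tau> ^ k + (A + \<delta>) * R / s)"
        unfolding rmean_def
      proof (rule integral_le)
        fix \<tau> :: real assume \<tau>: "\<tau> \<in> {0..1}"
        show "\<tau> ^ k * g (s * \<tau>) \<le> (- \<delta>) * \<tau> ^ k + (A + \<delta>) * R / s"
        proof (cases "s * \<tau> \<ge> R")
          case True
          have "\<tau> ^ k * g (s * \<tau>) \<le> \<tau> ^ k * (- \<delta>)"
            using \<tau> g(3)[OF True] by (intro mult_left_mono) auto
          moreover have "0 \<le> (A + \<delta>) * R / s" using A \<delta> R s0 by simp
          ultimately show ?thesis by (simp add: mult_ac)
        next
          case False
          hence "\<tau> \<le> R / s" using s0 by (simp add: field_simps)
          moreover have "\<tau> ^ k \<le> \<tau> ^ 1" using k \<tau> by (intro power_decreasing) auto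
          ultimately have "\<tau> ^ k \<le> R / s" by simp
          moreover have "\<tau> ^ k * g (s * \<tau>) \<le> \<tau> ^ k * A"
            using \<tau> s0 g(2)[of "s * \<tau>"] by (intro mult_left_mono) auto
          moreover have "(A + \<delta>) * \<tau> ^ k \<le> (A + \<delta>) * (R / s)"
            using A \<delta> \<open>\<tau> ^ k \<le> R / s\<close> by (intro mult_left_mono) auto
          ultimately show ?thesis by (simp add: algebra_simps add_divide_distrib)
        qed
      next
        show "(\<lambda>\<tau>. - \<delta> * \<tau> ^ k + (A + \<delta>) * R / s) integrable_on {0..1}"
          by (intro integrable_continuous_real continuous_intros)
      qed (use rmean_integrable[OF g(1)] s0 in auto)
      also have "\<dots> = - \<delta> / real (k + 1) + (A + \<delta>) * R / s"
      proof -
        have "((\<lambda>\<tau>. (- \<delta>) * \<tau> ^ k + (A + \<delta>) * R / s) has_integral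
            ((- \<delta>) * 1 ^ Suc k / real (Suc k) + (A + \<delta>) * R / s * 1) - ((- \<delta>) * 0 ^ Suc k / real (Suc k) + (A + \<delta>) * R / s * 0)) {0..1}"
          by (rule fundamental_theorem_of_calculus)
            (use s0 in \<open>auto simp flip: has_real_derivative_iff_has_vector_derivative
              intro!: derivative_eq_intros simp del: power_Suc of_nat_Suc\<close>)
        thus ?thesis by (simp add: integral_unique)
      qed
      also have "(A + \<delta>) * R / s \<le> (A + \<delta>) * R / S" using s S A \<delta> R by (intro divide_left_mono) auto
      also have "(A + \<delta>) * R / S \<le> \<delta> / (2 * real (k + 1))"
      proof -
        have "2 * real (k + 1) * ((A + \<delta>) * R) = (S - 1) * \<delta>" using \<delta> by (simp add: S_def)
        also have "\<dots> \<le> \<delta> * S" using \<delta> by (simp add: algebra_simps)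
        finally show ?thesis using S by (simp add: field_simps)
      qed
      also have "- \<delta> / real (k + 1) + \<delta> / (2 * real (k + 1)) = - (4 * \<epsilon>)"
        unfolding \<epsilon>_def by (simp add: field_simps del: of_nat_add of_nat_Suc)
      finally show ?thesis by simp
    qed
    show ?thesis
    proof (cases "t \<le> S")
      case True
      thus ?thesis using small[OF t True] by simp
    next
      case False
      have "rpot k g t + \<epsilon> * t \<le> rpot k g S + \<epsilon> * S"
      proof (rule antitone_on_atLeast[where f = "\<lambda>t. rpot k g t + \<epsilon> * t" and a = S])
        show "((\<lambda>t. rpot k g t + \<epsilon> * t) has_real_derivative rmean k g s / 4 + \<epsilon> * 1) (at s within {S..})"
          if "s \<ge> S" for s
          using that S
          by (intro DERIV_add DERIV_cmult DERIV_ident DERIV_subset[OF rpot_has_derivative[OF g(1)]]) auto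
        show "rmean k g s / 4 + \<epsilon> * 1 \<le> 0" if "s \<ge> S" for s using m[OF that] by simp
      qed (use False in auto)
      also have "\<dots> \<le> A * S + \<epsilon> * S" using S by (intro small) auto
      finally show ?thesis by simp
    qed
  qed
  thus ?thesis using \<epsilon> by blast
qed

text \<open>A potential turns C' - \<epsilon>' t into \<alpha> t - \<gamma> t^2, with coefficients
  read off from \<open>rpot_monomial\<close>. Completing the square puts this below a line of slope
  -1, so linear decay survives every further potential.\<close>

lemma funpow_rpot_linear_decay:
  assumes "\<epsilon> > 0"
  shows "\<exists>C' \<epsilon>'. \<epsilon>' > 0 \<and> (\<forall>f. continuous_on {0..} f \<longrightarrow> (\<forall>t\<ge>0. f t \<le> C - \<epsilon> * t) \<longrightarrow>
    (\<forall>t\<ge>0. (rpot k ^^ j) f t \<le> C' - \<epsilon>' * t))"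
proof (induction j)
  case 0
  show ?case using assms by auto
next
  case (Suc j)
  then obtain C' \<epsilon>' where e: "\<epsilon>' > 0"
    and IH: "\<And>f t. continuous_on {0..} f \<Longrightarrow> (\<And>t. t \<ge> 0 \<Longrightarrow> f t \<le> C - \<epsilon> * t) \<Longrightarrow> t \<ge> 0 \<Longrightarrow>
      (rpot k ^^ j) f t \<le> C' - \<epsilon>' * t" by blast
  define \<alpha> \<gamma> where "\<alpha> = C' / (4 * real (k + 1))" and "\<gamma> = \<epsilon>' / (8 * real (k + 2))"
  have \<gamma>: "\<gamma> > 0" using e by (simp add: \<gamma>_def)
  have "(rpot k ^^ Suc j) f t \<le> (\<alpha> + 1)\<^sup>2 / (4 * \<gamma>) - 1 * t"
    if f: "continuous_on {0..} f" "\<And>t. t \<ge> 0 \<Longrightarrow> f t \<le> C - \<epsilon> * t" and t: "t \<ge> 0" for f t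
  proof -
    have "rpot k ((rpot k ^^ j) f) t \<le> rpot k (\<lambda>t. C' * t ^ 0 + (- \<epsilon>') * t ^ 1) t"
      using IH[OF f]
      by (intro rpot_mono) (auto intro!: continuous_intros continuous_on_funpow_rpot f)
    also have "\<dots> = C' * rpot k (\<lambda>t. t ^ 0) t + (- \<epsilon>') * rpot k (\<lambda>t. t ^ 1) t"
      by (rule rpot_linear) (intro continuous_intros)+
    also have "\<dots> = \<alpha> * t - \<gamma> * t\<^sup>2"
      unfolding rpot_monomial[OF t] \<alpha>_def \<gamma>_def by (simp add: power2_eq_square)
    also have "\<dots> \<le> (\<alpha> + 1)\<^sup>2 / (4 * \<gamma>) - 1 * t"
    proof -
      have "0 \<le> (2 * \<gamma> * t - (\<alpha> + 1))\<^sup>2 / (4 * \<gamma>)" using \<gamma> by simp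
      also have "\<dots> = (\<alpha> + 1)\<^sup>2 / (4 * \<gamma>) - (\<alpha> + 1) * t + \<gamma> * t\<^sup>2"
        using \<gamma> by (simp add: field_simps power2_eq_square)
      finally show ?thesis by (simp add: algebra_simps)
    qed
    finally show ?thesis by simp
  qed
  thus ?case by (meson zero_less_one)
qed

text \<open>The first potential produces linear decay from the sign of the top profile, and the
  other k - 1 keep it. The constants are uniform over all a <= A, with no lower bound on
  \<open>a\<close>, so they also serve the limit a -> -\<infinity>.\<close>

lemma radial_solution_decay:
  assumes k: "k \<ge> 1" and c: "c > 0" and \<beta>: "\<beta> \<ge> 0" and A: "A \<ge> 0"
  obtains C \<epsilon> where "\<epsilon> > 0"
    and "\<And>a y t. radial_solution k c \<beta> a y \<Longrightarrow> a \<le> A \<Longrightarrow> t \<ge> 0 \<Longrightarrow> y t \<le> C - \<epsilon> * t"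
proof -
  define R where "R = max 1 (4 * real (k + 1) * (A + 1) * exp \<beta> / c)"
  define \<delta> where "\<delta> = 1 / R ^ k"
  have R1: "R \<ge> 1" "R \<ge> 4 * real (k + 1) * (A + 1) * exp \<beta> / c" by (auto simp: R_def)
  have R: "R \<ge> 0" and \<delta>: "\<delta> > 0" using R1(1) by (auto simp: \<delta>_def)
  from rpot_linear_decay[OF k \<delta> A R] obtain C1 e1 where 1: "e1 > 0 \<and>
      (\<forall>g. continuous_on {0..} g \<longrightarrow> (\<forall>t\<ge>0. g t \<le> A) \<longrightarrow> (\<forall>t\<ge>R. g t \<le> - \<delta>) \<longrightarrow>
        (\<forall>t\<ge>0. rpot k g t \<le> C1 - e1 * t))"
    by (elim exE)
  from funpow_rpot_linear_decay[OF conjunct1[OF 1], of C1 "k - 1" k] obtain C2 e2 where 2: "e2 > 0 \<and>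
      (\<forall>f. continuous_on {0..} f \<longrightarrow> (\<forall>t\<ge>0. f t \<le> C1 - e1 * t) \<longrightarrow>
        (\<forall>t\<ge>0. (rpot k ^^ (k - 1)) f t \<le> C2 - e2 * t))"
    by (elim exE)
  have "y t \<le> C2 - e2 * t"
    if y: "radial_solution k c \<beta> a y" and a: "a \<le> A" and t: "t \<ge> 0" for a y t
  proof -
    let ?g = "\<lambda>t. a - c * rpot k (\<lambda>s. exp (\<beta> * y s)) t"
    have cy: "continuous_on {0..} y" and y_eq: "y = (rpot k ^^ k) ?g"
      using y by (auto simp: radial_solution_def)
    have cg: "continuous_on {0..} ?g" by (intro continuous_intros continuous_on_rpot_exp cy)
    have anti: "?g t \<le> ?g s" if "0 \<le> s" "s \<le> t" for s t
      by (rule radial_top_antitone[OF cy less_imp_le[OF c] that])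
    have gR: "?g R \<le> - \<delta>" unfolding \<delta>_def by (rule radial_top_neg[OF y c \<beta> R1 a])
    have "?g t \<le> A" if "t \<ge> 0" for t using anti[of 0 t] that a by simp
    moreover have "?g t \<le> - \<delta>" if "t \<ge> R" for t using anti[of R t] that R gR by simp
    ultimately have "rpot k ?g t \<le> C1 - e1 * t" if "t \<ge> 0" for t
      using conjunct2[OF 1, rule_format, OF cg] that by simp
    hence "(rpot k ^^ (k - 1)) (rpot k ?g) t \<le> C2 - e2 * t"
      using conjunct2[OF 2, rule_format, OF continuous_on_rpot[OF cg]] t by simp
    moreover have "(rpot k ^^ (k - 1)) (rpot k ?g) = y"
    proof -
      have "(rpot k ^^ k) ?g = (rpot k ^^ Suc (k - 1)) ?g" using k by simp
      also have "\<dots> = (rpot k ^^ (k - 1)) (rpot k ?g)" unfolding funpow_Suc_right o_def ..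
      finally show ?thesis using y_eq by simp
    qed
    ultimately show ?thesis by simp
  qed
  with 2 show thesis by (intro that[of e2 C2]) auto
qed

section \<open>A lower bound for the volume, and integration in the variable |x|^2\<close>

lemma has_integral_rmean:
  assumes f: "Ck 1 f" and s: "s \<ge> 0"
  shows "((\<lambda>r. r ^ k * f r) has_integral s ^ Suc k * rmean k f s) {0..s}"
proof -
  obtain f' where f': "\<And>t. t \<ge> 0 \<Longrightarrow> (f has_real_derivative f' t) (at t within {0..})" "continuous_on {0..} f'"
    using f by auto
  \<comment> \<open>By \<open>rmean_ode\<close>, r^(k+1) times the mean is an antiderivative of r^k
    f(r), and it vanishes at 0.\<close>
  have "((\<lambda>r. r ^ k * f r) has_integral s ^ Suc k * rmean k f s - 0 ^ Suc k * rmean k f 0) {0..s}"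
  proof (rule fundamental_theorem_of_calculus[OF s])
    fix x :: real assume x: "x \<in> {0..s}"
    have "((\<lambda>r. r ^ Suc k * rmean k f r) has_real_derivative
        (real (Suc k) * x ^ k) * rmean k f x + rmean (Suc k) f' x * x ^ Suc k) (at x within {0..})"
      by (rule DERIV_mult[OF _ rmean_has_derivative[OF f']])
        (use x in \<open>auto intro!: derivative_eq_intros simp del: power_Suc\<close>)
    also have "(real (Suc k) * x ^ k) * rmean k f x + rmean (Suc k) f' x * x ^ Suc k = x ^ k * f x"
      by (subst rmean_ode[OF f', symmetric]) (use x in \<open>auto simp: algebra_simps\<close>)
    finally show "((\<lambda>r. r ^ Suc k * rmean k f r) has_vector_derivative x ^ k * f x) (at x within {0..s})"
      unfolding has_real_derivative_iff_has_vector_derivative[symmetric]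
      by (rule DERIV_subset) auto
  qed
  thus ?thesis by simp
qed

text \<open>Put r = e^(-\<beta> K), so a = K / r^k. On [0,r] one has y <= a r^k = K, so the
  exponential is at most 1/r and its potential at r at most 1. Beyond r its mean is at most
  V/s^(k+1), so the potential gains at most V/(4 k r^k). Yet it must exceed a/c somewhere;
  multiplying by r^k turns this into the claim.\<close>

lemma radial_solution_volume_lower:
  assumes y: "radial_solution k c \<beta> a y" and k: "k \<ge> 1" and c: "c > 0" and \<beta>: "\<beta> \<ge> 0"
    and K: "K \<ge> 0" and a: "a = K / exp (- \<beta> * K) ^ k"
    and V: "\<And>s. s \<ge> 0 \<Longrightarrow> s ^ Suc k * rmean k (\<lambda>s. exp (\<beta> * y s)) s \<le> V"
  shows "V \<ge> 4 * real k * (K / c - 1)"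
proof -
  define E where "E s = exp (\<beta> * y s)" for s
  define r where "r = exp (- \<beta> * K)"
  have r: "r > 0" "r \<le> 1" using \<beta> K by (auto simp: r_def)
  have a0: "a \<ge> 0" using K by (simp add: a)
  have cE: "continuous_on {0..} E"
    using y unfolding E_def radial_solution_def by (auto intro!: continuous_intros)
  have V0: "V \<ge> 0" using V[of 0] by simp
  have E_le: "E s \<le> exp (\<beta> * K)" if s: "0 \<le> s" "s \<le> r" for s
  proof -
    obtain \<kappa> where \<kappa>: "0 < \<kappa>" "\<kappa> \<le> 1" "(rpot k ^^ k) (\<lambda>_. 1) s = \<kappa> * s ^ k"
      using funpow_rpot_one[of k k] s by metis
    have "y s \<le> a * (\<kappa> * s ^ k)" using radial_solution_le[OF y _ s(1)] c \<kappa>(3) by simp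
    also have "\<dots> \<le> a * (1 * r ^ k)"
      using a0 \<kappa> s by (intro mult_left_mono mult_mono power_mono) auto
    also have "\<dots> = K" using r by (simp add: a r_def)
    finally show ?thesis using \<beta> by (simp add: E_def mult_left_mono)
  qed
  have "rpot k E r \<le> rpot k (\<lambda>_. exp (\<beta> * K)) r"
    by (rule rpot_mono) (use cE E_le in auto)
  also have "\<dots> = 1 / (4 * real (k + 1))"
    using r by (subst rpot_const) (auto simp: r_def simp flip: exp_add)
  also have "\<dots> \<le> 1" by simp
  finally have Er: "rpot k E r \<le> 1" .
  \<comment> \<open>The added multiple of t^-k has derivative -V/(4 t^(k+1)), exactly offsetting the
    bound on the growth of the potential.\<close>
  define \<phi> where "\<phi> t = rpot k E t + V / (4 * real k) * inverse (t ^ k)" for t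
  have \<phi>: "\<phi> t \<le> \<phi> r" if t: "t \<ge> r" for t
  proof (rule antitone_on_atLeast[where f = \<phi> and a = r])
    fix s assume s: "s \<ge> r"
    have s0: "s > 0" using s r by simp
    obtain j where j: "k = Suc j" using k by (cases k) auto
    have "((\<lambda>t. inverse (t ^ k)) has_real_derivative - (inverse (s ^ k) * (real k * s ^ (k - 1)) * inverse (s ^ k))) (at s within {r..})"
      using s0 by (auto intro!: derivative_eq_intros)
    also have "- (inverse (s ^ k) * (real k * s ^ (k - 1)) * inverse (s ^ k)) = - (real k / s ^ Suc k)"
      using s0 by (simp add: j field_simps)
    finally have "(\<phi> has_real_derivative rmean k E s / 4 + V / (4 * real k) * - (real k / s ^ Suc k)) (at s within {r..})"
      unfolding \<phi>_def using s0 r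
      by (intro DERIV_add DERIV_cmult DERIV_subset[OF rpot_has_derivative[OF cE]]) auto
    thus "(\<phi> has_real_derivative rmean k E s / 4 - V / (4 * s ^ Suc k)) (at s within {r..})"
      using k s0 by (simp add: field_simps)
    have "rmean k E s \<le> V / s ^ Suc k"
      using V[of s] s0 unfolding E_def by (simp add: pos_le_divide_eq mult_ac)
    thus "rmean k E s / 4 - V / (4 * s ^ Suc k) \<le> 0" by simp
  qed (use t in auto)
  \<comment> \<open>The radius at which \<open>radial_top_neg\<close>, with A = a, makes the top
    profile negative.\<close>
  define t where "t = max 1 (4 * real (k + 1) * (a + 1) * exp \<beta> / c)"
  have t1: "t \<ge> 1" "t \<ge> 4 * real (k + 1) * (a + 1) * exp \<beta> / c" by (auto simp: t_def)
  hence t: "t \<ge> r" using r by simp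
  have "a - c * rpot k E t \<le> - (1 / t ^ k)"
    unfolding E_def by (rule radial_top_neg[OF y c \<beta> t1 order_refl])
  moreover have "1 / t ^ k > 0" using t1 by simp
  ultimately have "a - c * rpot k E t < 0" by linarith
  hence "a / c < rpot k E t" using c by (simp add: field_simps)
  also have "\<dots> \<le> \<phi> t" unfolding \<phi>_def using V0 t r by simp
  also have "\<dots> \<le> \<phi> r" by (rule \<phi>[OF t])
  also have "\<dots> \<le> 1 + V / (4 * real k) * inverse (r ^ k)" unfolding \<phi>_def using Er by simp
  finally have "r ^ k * (a / c - 1) \<le> r ^ k * (V / (4 * real k) * inverse (r ^ k))"
    using r by (intro mult_left_mono) auto
  moreover have "r ^ k * (a / c - 1) = K / c - r ^ k"
  proof -
    have "r ^ k * a = K" using r by (simp add: a r_def)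
    thus ?thesis by (simp add: right_diff_distrib)
  qed
  moreover have "r ^ k * (V / (4 * real k) * inverse (r ^ k)) = V / (4 * real k)"
    using r by simp
  ultimately have "K / c - r ^ k \<le> V / (4 * real k)" by (simp only:)
  moreover have "r ^ k \<le> 1" using r by (simp add: power_le_one)
  ultimately have "K / c - 1 \<le> V / (4 * real k)" by linarith
  thus ?thesis using k by (simp add: field_simps)
qed

text \<open>The image of Lebesgue measure under x -> |x|^2 gives {..a} the volume of the ball of
  radius sqrt a, a multiple of a^(k+1) for a >= 0. The density (k+1) r^k with the same factor gives
  the same value, and half-lines form an intersection-stable generator.\<close>

lemma nn_integral_radial:
  fixes f :: "real \<Rightarrow> ennreal"
  assumes n: "CARD('n::finite) = 2 * Suc k" and f: "f \<in> borel_measurable borel"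
  shows "(\<integral>\<^sup>+ x. f (x \<bullet> x) \<partial>(lborel :: (real^'n) measure)) =
    ennreal (unit_ball_vol (2 * Suc k) * real (Suc k)) *
      (\<integral>\<^sup>+ r. ennreal (indicator {0..} r * r ^ k) * f r \<partial>lborel)"
proof -
  define \<omega> where "\<omega> = unit_ball_vol (2 * Suc k)"
  define h where "h r = \<omega> * real (Suc k) * (indicator {0..} r * r ^ k)" for r :: real
  have \<omega>: "\<omega> \<ge> 0" by (simp add: \<omega>_def)
  have q: "(\<lambda>x :: real^'n. x \<bullet> x) \<in> borel_measurable lborel" by simp
  have h0: "h r \<ge> 0" for r using \<omega> by (simp add: h_def indicator_def)
  have h_meas [measurable]: "h \<in> borel_measurable borel" unfolding h_def by measurable
  have distr: "emeasure (distr lborel borel (\<lambda>x :: real^'n. x \<bullet> x)) {..a}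
      = ennreal (if a \<ge> 0 then \<omega> * a ^ Suc k else 0)" for a
  proof -
    have "emeasure (distr lborel borel (\<lambda>x :: real^'n. x \<bullet> x)) {..a} = emeasure lborel {x :: real^'n. x \<bullet> x \<le> a}"
      by (subst emeasure_distr) (auto simp: vimage_def)
    also have "\<dots> = ennreal (if a \<ge> 0 then \<omega> * a ^ Suc k else 0)"
    proof (cases "a \<ge> 0")
      case True
      have "{x :: real^'n. x \<bullet> x \<le> a} = cball 0 (sqrt a)"
        by (auto simp: norm_eq_sqrt_inner)
      moreover have "sqrt a ^ (2 * Suc k) = a ^ Suc k"
        using True by (simp only: power_mult) simp
      ultimately show ?thesis using True
        by (simp add: emeasure_cball n \<omega>_def)
    next
      case False
      hence "{x :: real^'n. x \<bullet> x \<le> a} = {}"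
        using inner_ge_zero order_trans by (metis (mono_tags, lifting) empty_Collect_eq)
      thus ?thesis using False by (simp only: emeasure_empty if_False ennreal_0)
    qed
    finally show ?thesis .
  qed
  have density: "emeasure (density lborel (\<lambda>r. ennreal (h r))) {..a}
      = ennreal (if a \<ge> 0 then \<omega> * a ^ Suc k else 0)" for a
  proof (cases "a \<ge> 0")
    case True
    have "emeasure (density lborel (\<lambda>r. ennreal (h r))) {..a}
        = (\<integral>\<^sup>+ r. ennreal (\<omega> * (real (Suc k) * r ^ k)) * indicator {0..a} r \<partial>lborel)"
      by (subst emeasure_density) (auto simp: h_def indicator_def mult.assoc intro!: nn_integral_cong)
    also have "\<dots> = ennreal (\<omega> * a ^ Suc k - \<omega> * 0 ^ Suc k)"
      by (rule nn_integral_FTC_Icc)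
        (use True \<omega> in \<open>auto intro!: derivative_eq_intros simp del: power_Suc of_nat_Suc\<close>)
    finally show ?thesis using True by simp
  next
    case False
    hence z: "ennreal (h r) * indicator {..a} r = 0" for r by (auto simp: h_def indicator_def)
    have "emeasure (density lborel (\<lambda>r. ennreal (h r))) {..a}
        = (\<integral>\<^sup>+ r. ennreal (h r) * indicator {..a} r \<partial>lborel)"
      by (rule emeasure_density) auto
    also have "\<dots> = 0" unfolding z by simp
    finally show ?thesis using False by simp
  qed
  have sets_borel: "sets (borel :: real measure) = sigma_sets UNIV (range (\<lambda>a. {..a}))"
    by (subst borel_eq_atMost) (simp add: sets_measure_of)
  have distr_eq: "distr lborel borel (\<lambda>x :: real^'n. x \<bullet> x) = density lborel (\<lambda>r. ennreal (h r))"
  proof (rule measure_eqI_generator_eq[where E = "range (\<lambda>a. {..a})" and \<Omega> = UNIV and A = "\<lambda>i. {..real i}"])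
    show "Int_stable (range (\<lambda>a :: real. {..a}))"
      unfolding Int_stable_def by auto
    show "(\<Union>i. {..real i}) = UNIV" using real_arch_simple by auto
  qed (auto simp: sets_borel distr density simp del: power_Suc)
  have "(\<integral>\<^sup>+ x. f (x \<bullet> x) \<partial>(lborel :: (real^'n) measure))
      = (\<integral>\<^sup>+ r. f r \<partial>distr lborel borel (\<lambda>x :: real^'n. x \<bullet> x))"
    by (rule nn_integral_distr[symmetric]) (use q f in auto)
  also have "\<dots> = (\<integral>\<^sup>+ r. f r \<partial>density lborel (\<lambda>r. ennreal (h r)))"
    unfolding distr_eq ..
  also have "\<dots> = (\<integral>\<^sup>+ r. ennreal (h r) * f r \<partial>lborel)"
    by (rule nn_integral_density) (use f in auto)
  also have "\<dots> = (\<integral>\<^sup>+ r. ennreal (\<omega> * real (Suc k)) * (ennreal (indicator {0..} r * r ^ k) * f r) \<partial>lborel)"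
    using \<omega> by (auto simp: h_def indicator_def ennreal_mult mult.assoc intro!: nn_integral_cong simp del: of_nat_Suc)
  also have "\<dots> = ennreal (\<omega> * real (Suc k)) * (\<integral>\<^sup>+ r. ennreal (indicator {0..} r * r ^ k) * f r \<partial>lborel)"
    by (rule nn_integral_cmult) (use f in measurable)
  finally show ?thesis unfolding \<omega>_def .
qed

section \<open>Majorants and dominated convergence for radial integrals\<close>

lemma power_le_exp:
  fixes z :: real
  assumes "z \<ge> 0" "N > 0"
  shows "z ^ N \<le> real N ^ N * exp z"
proof -
  have "z / real N \<le> exp (z / real N)" using exp_ge_add_one_self[of "z / real N"] by linarith
  hence "(z / real N) ^ N \<le> exp (z / real N) ^ N" using assms by (intro power_mono) auto
  also have "\<dots> = exp z" using assms by (simp flip: exp_of_nat_mult)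
  finally show ?thesis using assms by (simp add: power_divide field_simps)
qed

lemma integrable_inverse_square: "integrable lborel (\<lambda>r :: real. indicator {0..} r / (1 + r)\<^sup>2)"
proof (rule integrableI_nonneg)
  have "(\<integral>\<^sup>+ r. ennreal (indicator {0..} r / (1 + r)\<^sup>2) \<partial>lborel)
      = (\<integral>\<^sup>+ r. ennreal (1 / (1 + r)\<^sup>2) * indicator {0..} r \<partial>(lborel :: real measure))"
    by (intro nn_integral_cong) (auto simp: indicator_def)
  also have "\<dots> = ennreal (0 - (- (1 / (1 + 0))))"
  proof (rule nn_integral_FTC_atLeast[where F = "\<lambda>r. - (1 / (1 + r))"])
    show "((\<lambda>r :: real. - (1 / (1 + r))) \<longlongrightarrow> 0) at_top" by real_asymp
    show "((\<lambda>r. - (1 / (1 + r))) has_real_derivative 1 / (1 + x)\<^sup>2) (at x)" if "x \<ge> 0" for x :: real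
      using that by (auto intro!: derivative_eq_intros simp: power2_eq_square field_simps)
  qed auto
  finally show "(\<integral>\<^sup>+ r. ennreal (indicator {0..} r / (1 + r)\<^sup>2) \<partial>(lborel :: real measure)) < \<infinity>" by simp
qed auto

lemma power_exp_le_inverse_square:
  fixes b :: real
  assumes "b > 0"
  obtains M where "M \<ge> 0" "\<And>r. r \<ge> 0 \<Longrightarrow> r ^ k * exp (- b * r) \<le> M / (1 + r)\<^sup>2"
proof
  \<comment> \<open>k powers of 1 + r come from bounding r^k and two from the quadratic weight. The
    constant M is \<open>power_le_exp\<close> at z = b(1 + r), with e^b accounting for the shift by
    1.\<close>
  define N where "N = k + 2"
  define M where "M = real N ^ N / b ^ N * exp b"
  show "M \<ge> 0" using assms by (simp add: M_def)
  fix r :: real assume r: "r \<ge> 0"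
  have "r ^ k * (1 + r)\<^sup>2 \<le> (1 + r) ^ k * (1 + r)\<^sup>2"
    using r by (intro mult_right_mono power_mono) auto
  also have "\<dots> = (b * (1 + r)) ^ N / b ^ N"
    using assms unfolding power_mult_distrib N_def power_add by simp
  also have "\<dots> \<le> real N ^ N * exp (b * (1 + r)) / b ^ N"
    using assms r by (intro divide_right_mono power_le_exp) (auto simp: N_def)
  also have "\<dots> = M * exp (b * r)"
    by (simp add: M_def distrib_left exp_add)
  finally have "r ^ k * (1 + r)\<^sup>2 * exp (- b * r) \<le> M * exp (b * r) * exp (- b * r)"
    by (rule mult_right_mono) simp
  hence "r ^ k * exp (- b * r) * (1 + r)\<^sup>2 \<le> M"
    by (simp add: mult_ac flip: exp_add)
  thus "r ^ k * exp (- b * r) \<le> M / (1 + r)\<^sup>2"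
    using r by (simp add: pos_le_divide_eq add_pos_nonneg)
qed

text \<open>Up to the factor \<open>unit_ball_vol (2 * Suc k) * real (Suc k)\<close> this is the
  integral of f(|x|^2) over R^(2(k+1)).\<close>

definition rint :: "nat \<Rightarrow> (real \<Rightarrow> real) \<Rightarrow> real" where
  "rint k f = (LINT r|lborel. indicator {0..} r *\<^sub>R (r ^ k * f r))"

lemma rint_measurable:
  assumes "continuous_on {0..} f"
  shows "(\<lambda>r. indicator {0..} r *\<^sub>R (r ^ k * f r :: real)) \<in> borel_measurable lborel"
  using borel_measurable_continuous_on_indicator[of "{0..}" "\<lambda>r. r ^ k * f r"] assms
  by (simp add: continuous_on_mult continuous_on_power)

text \<open>The majorant \<open>w\<close> is fixed before \<open>f\<close>, so it dominates a whole
  sequence at once.\<close>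

lemma rint_bound:
  assumes "b > (0 :: real)" and "B \<ge> 0"
  obtains w where "integrable lborel w"
    and "\<And>f r. (\<And>r. r \<ge> 0 \<Longrightarrow> \<bar>f r\<bar> \<le> B * exp (- b * r)) \<Longrightarrow>
      norm (indicator {0..} r *\<^sub>R (r ^ k * f r :: real)) \<le> w r"
proof -
  obtain M where M: "M \<ge> 0" "\<And>r. r \<ge> 0 \<Longrightarrow> r ^ k * exp (- b * r) \<le> M / (1 + r)\<^sup>2"
    using power_exp_le_inverse_square[OF assms(1)] by metis
  show thesis
  proof
    show "integrable lborel (\<lambda>r. (B * M) * (indicator {0..} r / (1 + r)\<^sup>2))"
      by (intro integrable_mult_right integrable_inverse_square)
    fix f :: "real \<Rightarrow> real" and r :: real
    assume f: "\<And>r. r \<ge> 0 \<Longrightarrow> \<bar>f r\<bar> \<le> B * exp (- b * r)"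
    show "norm (indicator {0..} r *\<^sub>R (r ^ k * f r)) \<le> (B * M) * (indicator {0..} r / (1 + r)\<^sup>2)"
    proof (cases "r \<ge> 0")
      case True
      have "r ^ k * \<bar>f r\<bar> \<le> r ^ k * (B * exp (- b * r))"
        using True f[OF True] by (intro mult_left_mono) auto
      also have "\<dots> = B * (r ^ k * exp (- b * r))" by simp
      also have "\<dots> \<le> B * (M / (1 + r)\<^sup>2)" by (intro mult_left_mono M True assms)
      finally show ?thesis using True by (simp add: abs_mult)
    qed auto
  qed
qed

lemma rint_integrable:
  fixes f :: "real \<Rightarrow> real"
  assumes f: "continuous_on {0..} f" and b: "b > 0" "\<And>r. r \<ge> 0 \<Longrightarrow> \<bar>f r\<bar> \<le> B * exp (- b * r)"
  shows "integrable lborel (\<lambda>r. indicator {0..} r *\<^sub>R (r ^ k * f r))"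
proof -
  have "B \<ge> 0" using b(2)[of 0] abs_ge_zero[of "f 0"] by simp
  then obtain w where "integrable lborel w"
    "\<And>f r. (\<And>r. r \<ge> 0 \<Longrightarrow> \<bar>f r\<bar> \<le> B * exp (- b * r)) \<Longrightarrow> norm (indicator {0..} r *\<^sub>R (r ^ k * f r :: real)) \<le> w r"
    using rint_bound[OF b(1)] by metis
  note w = this
  have "norm (indicator {0..} r *\<^sub>R (r ^ k * f r)) \<le> norm (w r)" for r
    using w(2)[OF b(2), of r] by simp
  thus ?thesis
    by (intro Bochner_Integration.integrable_bound[OF w(1) rint_measurable[OF f]] AE_I2)
qed

text \<open>Convergence is asked for r > 0 only. This matters as a -> -\<infinity>: solutions vanish
  at 0, so their exponentials stay 1 there, but a point is a null set.\<close>

lemma rint_tendsto: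
  assumes f: "\<And>j. continuous_on {0..} (f j)" and g: "continuous_on {0..} g"
    and b: "b > 0" "\<And>j r. r \<ge> 0 \<Longrightarrow> \<bar>f j r\<bar> \<le> B * exp (- b * r)"
    and lim: "\<And>r. r > 0 \<Longrightarrow> (\<lambda>j. f j r) \<longlonglongrightarrow> g r"
  shows "(\<lambda>j. rint k (f j)) \<longlonglongrightarrow> rint k g"
proof -
  have "B \<ge> 0" using b(2)[of 0 0] by simp
  then obtain w where w: "integrable lborel w"
    "\<And>f r. (\<And>r. r \<ge> 0 \<Longrightarrow> \<bar>f r\<bar> \<le> B * exp (- b * r)) \<Longrightarrow> norm (indicator {0..} r *\<^sub>R (r ^ k * f r :: real)) \<le> w r"
    using rint_bound[OF b(1)] by metis
  show ?thesis unfolding rint_def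
  proof (rule integral_dominated_convergence[where w = w])
    have "AE r in lborel. r \<noteq> (0 :: real)" by (rule AE_lborel_singleton)
    thus "AE r in lborel. (\<lambda>j. indicator {0..} r *\<^sub>R (r ^ k * f j r)) \<longlonglongrightarrow> indicator {0..} r *\<^sub>R (r ^ k * g r)"
    proof eventually_elim
      case (elim r)
      show ?case
      proof (cases "r > 0")
        case True
        show ?thesis by (intro tendsto_intros lim True)
      qed (use elim in auto)
    qed
    show "AE r in lborel. norm (indicator {0..} r *\<^sub>R (r ^ k * f j r)) \<le> w r" for j
      by (intro AE_I2 w(2) b(2))
  qed (use rint_measurable f g w(1) in auto)
qed

lemma rmean_le_rint:
  assumes f: "Ck 1 f" "\<And>r. r \<ge> 0 \<Longrightarrow> f r \<ge> 0"
    and int: "integrable lborel (\<lambda>r. indicator {0..} r *\<^sub>R (r ^ k * f r))" and s: "s \<ge> 0"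
  shows "s ^ Suc k * rmean k f s \<le> rint k f"
proof -
  let ?h = "\<lambda>r. r ^ k * f r"
  have si: "set_integrable lborel {0..s} ?h"
    by (rule set_integrable_subset[of lborel "{0..}"]) (use int in \<open>auto simp: set_integrable_def\<close>)
  have "s ^ Suc k * rmean k f s = (LINT r:{0..s}|lborel. ?h r)"
    using set_borel_integral_eq_integral(2)[OF si] integral_unique[OF has_integral_rmean[OF f(1) s]] by simp
  also have "\<dots> \<le> rint k f"
    unfolding rint_def set_lebesgue_integral_def
    by (rule integral_mono) (use si int f(2) in \<open>auto simp: set_integrable_def indicator_def\<close>)
  finally show ?thesis .
qed

section \<open>Every positive volume is attained\<close>

lemma radial_solution_exp_decay:
  fixes c \<beta> A :: real
  assumes k: "k \<ge> 1" and c: "c > 0" and \<beta>: "\<beta> > 0" and A: "A \<ge> 0"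
  obtains b B where "b > 0"
    and "\<And>a y t. radial_solution k c \<beta> a y \<Longrightarrow> a \<le> A \<Longrightarrow> t \<ge> 0 \<Longrightarrow> \<bar>exp (\<beta> * y t)\<bar> \<le> B * exp (- b * t)"
proof -
  obtain C \<epsilon> where e: "\<epsilon> > 0"
    and le: "\<And>a y t. radial_solution k c \<beta> a y \<Longrightarrow> a \<le> A \<Longrightarrow> t \<ge> 0 \<Longrightarrow> y t \<le> C - \<epsilon> * t"
    using radial_solution_decay[OF k c less_imp_le[OF \<beta>] A] by metis
  show thesis
  proof
    show "\<beta> * \<epsilon> > 0" using \<beta> e by simp
    fix a y t assume "radial_solution k c \<beta> a y" "a \<le> A" "(t :: real) \<ge> 0"
    hence "\<beta> * y t \<le> \<beta> * (C - \<epsilon> * t)" using le \<beta> by (intro mult_left_mono) auto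
    hence "\<beta> * y t \<le> \<beta> * C + - (\<beta> * \<epsilon>) * t" by (simp add: algebra_simps)
    thus "\<bar>exp (\<beta> * y t)\<bar> \<le> exp (\<beta> * C) * exp (- (\<beta> * \<epsilon>) * t)"
      by (simp flip: exp_add)
  qed
qed

lemma continuous_on_exp_radial_solution:
  "radial_solution k c \<beta> a y \<Longrightarrow> continuous_on {0..} (\<lambda>s. exp (\<beta> * y s))"
  unfolding radial_solution_def by (auto intro!: continuous_intros)

text \<open>Along a = -j one has y <= -j \<kappa> r^k, so the exponential tends to 0 for each r > 0.
  The decay bound for a <= 0 is uniform, and dominated convergence sends the volumes to 0.\<close>

lemma radial_solution_volume_small:
  assumes k: "k \<ge> 1" and c: "c > 0" and \<beta>: "\<beta> > 0" and \<eta>: "\<eta> > 0"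
  obtains a where "a \<le> 0"
    and "\<And>y. radial_solution k c \<beta> a y \<Longrightarrow> rint k (\<lambda>s. exp (\<beta> * y s)) < \<eta>"
proof -
  have "\<exists>a\<le>0. \<forall>y. radial_solution k c \<beta> a y \<longrightarrow> rint k (\<lambda>s. exp (\<beta> * y s)) < \<eta>"
  proof (rule ccontr)
    assume "\<not> ?thesis"
    hence "\<exists>y. radial_solution k c \<beta> (- real j) y \<and> rint k (\<lambda>s. exp (\<beta> * y s)) \<ge> \<eta>" for j :: nat
      by (auto simp: not_less dest: spec[of _ "- real j"])
    then obtain y where y: "\<And>j. radial_solution k c \<beta> (- real j) (y j)"
      and ge: "\<And>j. rint k (\<lambda>s. exp (\<beta> * y j s)) \<ge> \<eta>" by metis
    obtain b B where b: "b > 0" and bd: "\<And>a y t. radial_solution k c \<beta> a y \<Longrightarrow> a \<le> 0 \<Longrightarrow> t \<ge> 0 \<Longrightarrow>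
        \<bar>exp (\<beta> * y t)\<bar> \<le> B * exp (- b * t)"
      using radial_solution_exp_decay[OF k c \<beta> order_refl] by metis
    obtain \<kappa> where \<kappa>: "0 < \<kappa>" "\<And>t. t \<ge> 0 \<Longrightarrow> (rpot k ^^ k) (\<lambda>_. 1) t = \<kappa> * t ^ k"
      using funpow_rpot_one[of k k] by metis
    have "(\<lambda>j. rint k (\<lambda>s. exp (\<beta> * y j s))) \<longlonglongrightarrow> rint k (\<lambda>_. 0)"
    proof (rule rint_tendsto[OF _ _ b])
      fix r :: real assume r: "r > 0"
      define q where "q = \<beta> * (\<kappa> * r ^ k)"
      have q: "q > 0" using \<beta> \<kappa>(1) r by (simp add: q_def)
      have "exp (\<beta> * y j r) \<le> exp (- q) ^ j" for j
      proof -
        have "y j r \<le> - real j * (\<kappa> * r ^ k)"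
          using radial_solution_le[OF y less_imp_le[OF c], of r j] \<kappa>(2)[of r] r by simp
        hence "\<beta> * y j r \<le> \<beta> * (- real j * (\<kappa> * r ^ k))" using \<beta> by (intro mult_left_mono) auto
        also have "\<dots> = real j * (- q)" by (simp add: q_def)
        finally show ?thesis by (simp flip: exp_of_nat_mult)
      qed
      moreover have "(\<lambda>j. exp (- q) ^ j) \<longlonglongrightarrow> 0" using q by (intro LIMSEQ_realpow_zero) auto
      ultimately show "(\<lambda>j. exp (\<beta> * y j r)) \<longlonglongrightarrow> 0"
        by (intro tendsto_sandwich[of "\<lambda>_. 0" "\<lambda>j. exp (\<beta> * y j r)" sequentially "\<lambda>j. exp (- q) ^ j"]) auto
    next
      show "continuous_on {0..} (\<lambda>s. exp (\<beta> * y j s))" for j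
        by (rule continuous_on_exp_radial_solution[OF y])
      show "\<bar>exp (\<beta> * y j r)\<bar> \<le> B * exp (- b * r)" if "r \<ge> 0" for j r
        by (rule bd[OF y _ that]) simp
    qed simp
    moreover have "rint k (\<lambda>_. 0) = 0" by (simp add: rint_def)
    ultimately have "\<eta> \<le> 0" by (intro LIMSEQ_le_const[of _ 0 \<eta>]) (use ge in auto)
    thus False using \<eta> by simp
  qed
  thus thesis using that by blast
qed

lemma radial_solution_volume_large:
  assumes k: "k \<ge> 1" and c: "c > 0" and \<beta>: "\<beta> > 0"
  obtains a where "a \<ge> 0"
    and "\<And>y. radial_solution k c \<beta> a y \<Longrightarrow> rint k (\<lambda>s. exp (\<beta> * y s)) \<ge> M"
proof -
  \<comment> \<open>Solves 4k(K/c - 1) = |M|; the absolute value keeps K nonnegative.\<close>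
  define K where "K = c * (1 + \<bar>M\<bar> / (4 * real k))"
  define a where "a = K / exp (- \<beta> * K) ^ k"
  have K: "K \<ge> 0" using c by (simp add: K_def)
  have a: "a \<ge> 0" using K by (simp add: a_def)
  show thesis
  proof (rule that[OF a])
    fix y assume y: "radial_solution k c \<beta> a y"
    let ?E = "\<lambda>s. exp (\<beta> * y s)"
    obtain b B where b: "b > 0" and bd: "\<And>a' y t. radial_solution k c \<beta> a' y \<Longrightarrow> a' \<le> a \<Longrightarrow> t \<ge> 0 \<Longrightarrow>
        \<bar>exp (\<beta> * y t)\<bar> \<le> B * exp (- b * t)"
      using radial_solution_exp_decay[OF k c \<beta> a] by metis
    have "4 * real k * (K / c - 1) \<le> rint k ?E"
    proof (rule radial_solution_volume_lower[OF y k c less_imp_le[OF \<beta>] K a_def rmean_le_rint])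
      show "Ck 1 ?E" using Cinf_radial_solution(2)[OF y] unfolding Cinf_def by blast
      show "integrable lborel (\<lambda>r. indicator {0..} r *\<^sub>R (r ^ k * ?E r))"
        by (rule rint_integrable[OF continuous_on_exp_radial_solution[OF y] b]) (use bd[OF y] in auto)
    qed auto
    moreover have "4 * real k * (K / c - 1) = \<bar>M\<bar>" using c k by (simp add: K_def)
    ultimately have "\<bar>M\<bar> \<le> rint k ?E" by (simp only:)
    thus "rint k ?E \<ge> M" by (rule order_trans[OF abs_ge_self])
  qed
qed

text \<open>Intermediate value theorem in \<open>a\<close>. Lipschitz dependence gives pointwise
  convergence and the uniform decay gives the majorant, so the volume is continuous in
  \<open>a\<close>. The bounds at \<open>a1\<close> and \<open>a2\<close> hold for every solution
  with that parameter, in particular for the family chosen here.\<close>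

lemma radial_solution_volume_attained:
  assumes k: "k \<ge> 1" and c: "c > 0" and \<beta>: "\<beta> > 0" and V: "V > 0"
  obtains a y where "radial_solution k c \<beta> a y"
    and "integrable lborel (\<lambda>r. indicator {0..} r *\<^sub>R (r ^ k * exp (\<beta> * y r)))"
    and "rint k (\<lambda>s. exp (\<beta> * y s)) = V"
proof -
  obtain a1 where a1: "a1 \<le> 0" "\<And>y. radial_solution k c \<beta> a1 y \<Longrightarrow> rint k (\<lambda>s. exp (\<beta> * y s)) < V"
    using radial_solution_volume_small[OF k c \<beta> V] by metis
  obtain a2 where a2: "a2 \<ge> 0" "\<And>y. radial_solution k c \<beta> a2 y \<Longrightarrow> rint k (\<lambda>s. exp (\<beta> * y s)) \<ge> V"
    using radial_solution_volume_large[OF k c \<beta>] by metis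
  define A where "A = max (- a1) a2"
  have A: "A \<ge> 0" "\<bar>a1\<bar> \<le> A" "\<bar>a2\<bar> \<le> A" using a1(1) a2(1) by (auto simp: A_def)
  obtain y W where y: "\<And>a. \<bar>a\<bar> \<le> A \<Longrightarrow> radial_solution k c \<beta> a (y a)"
    and lip: "\<And>a b t. \<bar>a\<bar> \<le> A \<Longrightarrow> \<bar>b\<bar> \<le> A \<Longrightarrow> t \<ge> 0 \<Longrightarrow> \<bar>y a t - y b t\<bar> \<le> \<bar>a - b\<bar> * W t"
    using radial_solution_exists[OF k less_imp_le[OF c] less_imp_le[OF \<beta>] A(1)] by metis
  obtain b B where b: "b > 0" and bd: "\<And>a y t. radial_solution k c \<beta> a y \<Longrightarrow> a \<le> A \<Longrightarrow> t \<ge> 0 \<Longrightarrow>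
      \<bar>exp (\<beta> * y t)\<bar> \<le> B * exp (- b * t)"
    using radial_solution_exp_decay[OF k c \<beta> A(1)] by metis
  have "continuous_on {a1..a2} (\<lambda>a. rint k (\<lambda>s. exp (\<beta> * y a s)))"
    unfolding continuous_on_sequentially o_def
  proof (intro allI ballI impI, elim conjE)
    fix x a assume a: "a \<in> {a1..a2}" and x: "\<forall>n. x n \<in> {a1..a2}" and lim: "x \<longlonglongrightarrow> a"
    have aA: "\<bar>a\<bar> \<le> A" and xA: "\<bar>x n\<bar> \<le> A" for n
      using a x by (auto simp: A_def abs_le_iff) (smt (verit) atLeastAtMost_iff)+
    show "(\<lambda>n. rint k (\<lambda>s. exp (\<beta> * y (x n) s))) \<longlonglongrightarrow> rint k (\<lambda>s. exp (\<beta> * y a s))"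
    proof (rule rint_tendsto[OF _ _ b])
      fix r :: real assume r: "r > 0"
      have "(\<lambda>n. \<bar>x n - a\<bar> * W r) \<longlonglongrightarrow> \<bar>a - a\<bar> * W r" by (intro tendsto_intros lim)
      hence z: "(\<lambda>n. \<bar>x n - a\<bar> * W r) \<longlonglongrightarrow> 0" by simp
      have "\<forall>n. norm (y (x n) r - y a r) \<le> \<bar>x n - a\<bar> * W r"
        using lip[OF xA aA less_imp_le[OF r]] by simp
      hence "(\<lambda>n. y (x n) r - y a r) \<longlonglongrightarrow> 0"
        by (intro Lim_null_comparison[OF always_eventually z])
      hence "(\<lambda>n. y (x n) r) \<longlonglongrightarrow> y a r" by (simp add: LIM_zero_iff)
      thus "(\<lambda>n. exp (\<beta> * y (x n) r)) \<longlonglongrightarrow> exp (\<beta> * y a r)" by (intro tendsto_intros)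
    next
      show "\<bar>exp (\<beta> * y (x n) r)\<bar> \<le> B * exp (- b * r)" if "r \<ge> 0" for n r
        using bd[OF y[OF xA] _ that] xA[of n] by simp
      show "continuous_on {0..} (\<lambda>s. exp (\<beta> * y (x n) s))" for n
        by (rule continuous_on_exp_radial_solution[OF y[OF xA]])
      show "continuous_on {0..} (\<lambda>s. exp (\<beta> * y a s))"
        by (rule continuous_on_exp_radial_solution[OF y[OF aA]])
    qed
  qed
  from IVT'[OF less_imp_le[OF a1(2)[OF y[OF A(2)]]] a2(2)[OF y[OF A(3)]] order_trans[OF a1(1) a2(1)] this]
  obtain a where a: "a1 \<le> a" "a \<le> a2" "rint k (\<lambda>s. exp (\<beta> * y a s)) = V" by blast
  have aA: "\<bar>a\<bar> \<le> A" using a by (auto simp: A_def abs_le_iff)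
  show thesis
    by (rule that[OF y[OF aA] rint_integrable[OF continuous_on_exp_radial_solution[OF y[OF aA]] b] a(3)],
        rule bd[OF y[OF aA]]) (use aA in auto)
qed

section \<open>Volumes on R^(2m) and the conclusion\<close>

lemma nn_integral_radial_exp:
  assumes n: "CARD('n::finite) = 2 * Suc k" and y: "continuous_on {0..} y"
    and int: "integrable lborel (\<lambda>r. indicator {0..} r *\<^sub>R (r ^ k * exp (\<beta> * y r)))"
  shows "(\<integral>\<^sup>+ x. ennreal (exp (\<beta> * y (x \<bullet> x))) \<partial>(lborel :: (real^'n) measure))
    = ennreal (unit_ball_vol (2 * Suc k) * real (Suc k) * rint k (\<lambda>r. exp (\<beta> * y r)))"
proof -
  \<comment> \<open>Continuity of y is known on [0,\<infinity>) only. Composing with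
    \<open>max 0\<close> gives a Borel function on the line with the same values at |x|^2.\<close>
  have "continuous_on UNIV (\<lambda>r. exp (\<beta> * y (max 0 r)))"
    by (intro continuous_intros continuous_on_compose2[OF y]) auto
  hence m: "(\<lambda>r. ennreal (exp (\<beta> * y (max 0 r)))) \<in> borel_measurable borel"
    by (intro measurable_compose[OF borel_measurable_continuous_onI measurable_ennreal])
  have "(\<integral>\<^sup>+ x. ennreal (exp (\<beta> * y (x \<bullet> x))) \<partial>(lborel :: (real^'n) measure))
      = (\<integral>\<^sup>+ x. ennreal (exp (\<beta> * y (max 0 (x \<bullet> x)))) \<partial>(lborel :: (real^'n) measure))"
    by simp
  also have "\<dots> = ennreal (unit_ball_vol (2 * Suc k) * real (Suc k)) *
      (\<integral>\<^sup>+ r. ennreal (indicator {0..} r * r ^ k) * ennreal (exp (\<beta> * y (max 0 r))) \<partial>lborel)"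
    by (rule nn_integral_radial[OF n m])
  also have "(\<integral>\<^sup>+ r. ennreal (indicator {0..} r * r ^ k) * ennreal (exp (\<beta> * y (max 0 r))) \<partial>lborel)
      = (\<integral>\<^sup>+ r. ennreal (indicator {0..} r *\<^sub>R (r ^ k * exp (\<beta> * y r))) \<partial>lborel)"
    by (intro nn_integral_cong) (auto simp: indicator_def max_def simp flip: ennreal_mult)
  also have "\<dots> = ennreal (rint k (\<lambda>r. exp (\<beta> * y r)))"
    unfolding rint_def by (rule nn_integral_eq_integral[OF int]) (auto simp: indicator_def)
  also have "ennreal (unit_ball_vol (2 * Suc k) * real (Suc k)) * \<dots>
      = ennreal (unit_ball_vol (2 * Suc k) * real (Suc k) * rint k (\<lambda>r. exp (\<beta> * y r)))"
    by (rule ennreal_mult'[symmetric]) auto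
  finally show ?thesis .
qed

text \<open>A real number above the volume of the sphere exists only if that volume is finite. In
  the variable r = |x|^2 the integrand is at most a constant times (1 + r)^-2.\<close>

lemma round_sphere_volume_finite:
  assumes n: "CARD('n::finite) = 2 * Suc k"
  shows "round_sphere_volume TYPE('n) < \<infinity>"
proof -
  let ?D = "\<lambda>r :: real. (2 / (1 + \<bar>r\<bar>)) ^ (2 * Suc k)"
  have "round_sphere_volume TYPE('n) = (\<integral>\<^sup>+ x. ennreal (?D (x \<bullet> x)) \<partial>(lborel :: (real^'n) measure))"
    unfolding round_sphere_volume_def volume_density_inv_stereographic n
    by (simp add: power2_norm_eq_inner)
  also have "\<dots> = ennreal (unit_ball_vol (2 * Suc k) * real (Suc k)) *
      (\<integral>\<^sup>+ r. ennreal (indicator {0..} r * r ^ k) * ennreal (?D r) \<partial>lborel)"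
    by (rule nn_integral_radial[OF n]) measurable
  also have "\<dots> < \<infinity>"
  proof -
    have "(\<integral>\<^sup>+ r. ennreal (indicator {0..} r * r ^ k) * ennreal (?D r) \<partial>lborel)
        \<le> (\<integral>\<^sup>+ r. ennreal (2 ^ (2 * Suc k) * (indicator {0..} r / (1 + r)\<^sup>2)) \<partial>lborel)"
    proof (rule nn_integral_mono)
      fix r :: real
      show "ennreal (indicator {0..} r * r ^ k) * ennreal (?D r)
          \<le> ennreal (2 ^ (2 * Suc k) * (indicator {0..} r / (1 + r)\<^sup>2))"
      proof (cases "r \<ge> 0")
        case True
        have "r ^ k * (1 + r)\<^sup>2 \<le> (1 + r) ^ (2 * k) * (1 + r)\<^sup>2"
          using True power_mono[of r "1 + r" k] power_increasing[of k "2 * k" "1 + r"]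
          by (intro mult_right_mono) auto
        also have "\<dots> = (1 + r) ^ (2 * Suc k)" by (simp add: power_add power2_eq_square)
        finally have le: "r ^ k * (1 + r)\<^sup>2 \<le> (1 + r) ^ (2 * Suc k)" .
        have "x / D \<le> 1 / Q" if "x * Q \<le> D" "D > 0" "Q > 0" for x D Q :: real
          using that by (simp add: field_simps)
        from this[OF le] have "r ^ k / (1 + r) ^ (2 * Suc k) \<le> 1 / (1 + r)\<^sup>2"
          using True by (simp add: add_pos_nonneg)
        hence "2 ^ (2 * Suc k) * (r ^ k / (1 + r) ^ (2 * Suc k)) \<le> 2 ^ (2 * Suc k) * (1 / (1 + r)\<^sup>2)"
          by (intro mult_left_mono) auto
        thus ?thesis using True
          by (simp add: power_divide mult_ac del: power_Suc mult_Suc_right flip: ennreal_mult)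
      qed auto
    qed
    also have "\<dots> < \<infinity>"
      using integrable_mult_right[OF integrable_inverse_square, of "2 ^ (2 * Suc k)"]
      by (subst nn_integral_eq_integral) auto
    finally show ?thesis by (simp add: ennreal_mult_less_top)
  qed
  finally show ?thesis .
qed

theorem theorem4:
  fixes m :: nat
  assumes "even m" and "m \<ge> 2" and "CARD('n::finite) = 2 * m"
  shows "\<exists>Vm :: real. ennreal Vm > round_sphere_volume TYPE('n) \<and> (\<forall>V. 0 < V \<and> V \<le> Vm \<longrightarrow>
    (\<exists>u :: real^'n \<Rightarrow> real. smooth u \<and>
      (\<forall>x. neg_laplacian_pow m u x = - fact (2 * m - 1) * exp (2 * real m * u x)) \<and>
      has_bochner_integral lborel (\<lambda>x. exp (2 * real m * u x)) V \<and>
      (\<forall>x. Q_curvature m u x = - fact (2 * m - 1)) \<and>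
      conformal_volume m u = ennreal V))"
proof -
  obtain k where m: "m = Suc k" and k: "k \<ge> 1" using assms(2) by (cases m) auto
  have n: "CARD('n) = 2 * Suc k" using assms(3) m by simp
  define c :: real where "c = fact (2 * m - 1)"
  define \<beta> where "\<beta> = 2 * real m"
  define \<omega> where "\<omega> = unit_ball_vol (2 * Suc k) * real (Suc k)"
  have c: "c > 0" and \<beta>: "\<beta> > 0" and \<omega>: "\<omega> > 0" by (auto simp: c_def \<beta>_def \<omega>_def m)
  have sol: "\<exists>u :: real^'n \<Rightarrow> real. smooth u \<and>
      (\<forall>x. neg_laplacian_pow m u x = - fact (2 * m - 1) * exp (2 * real m * u x)) \<and>
      has_bochner_integral lborel (\<lambda>x. exp (2 * real m * u x)) V \<and>
      (\<forall>x. Q_curvature m u x = - fact (2 * m - 1)) \<and>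
      conformal_volume m u = ennreal V" if V: "V > 0" for V
  proof -
    have "V / \<omega> > 0" using V \<omega> by simp
    then obtain a y where y: "radial_solution k c \<beta> a y"
      and int: "integrable lborel (\<lambda>r. indicator {0..} r *\<^sub>R (r ^ k * exp (\<beta> * y r)))"
      and rV: "rint k (\<lambda>s. exp (\<beta> * y s)) = V / \<omega>"
      using radial_solution_volume_attained[OF k c \<beta>] by metis
    define u where "u x = y (x \<bullet> x)" for x :: "real^'n"
    have cy: "continuous_on {0..} y" using y by (simp add: radial_solution_def)
    \<comment> \<open>Since m is even, k is odd, and the sign (-1)^k is -1.\<close>
    have pde: "neg_laplacian_pow m u x = - c * exp (\<beta> * u x)" for x
      using radial_solution_pde[OF y n, of x] assms(1) unfolding m u_def by simp
    have nn: "(\<integral>\<^sup>+ x. ennreal (exp (\<beta> * u x)) \<partial>lborel) = ennreal V"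
      unfolding u_def nn_integral_radial_exp[OF n cy int] rV \<omega>_def[symmetric] using \<omega> by simp
    have "continuous_on UNIV (\<lambda>x. exp (\<beta> * u x))"
      unfolding u_def by (intro continuous_intros continuous_on_compose2[OF cy]) auto
    hence bi: "has_bochner_integral lborel (\<lambda>x. exp (\<beta> * u x)) V"
      using nn V by (intro has_bochner_integral_nn_integral) (auto intro: borel_measurable_continuous_onI)
    show ?thesis
    proof (intro exI[of _ u] conjI allI)
      show "smooth u" unfolding u_def by (rule smooth_radial[OF Cinf_radial_solution(1)[OF y]])
      show "Q_curvature m u x = - fact (2 * m - 1)" for x
        unfolding Q_curvature_def pde by (simp add: \<beta>_def c_def mult_ac flip: exp_add)
    qed (use pde bi nn in \<open>simp_all add: \<beta>_def c_def conformal_volume_def\<close>)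
  qed
  obtain s where s: "s \<ge> 0" "round_sphere_volume TYPE('n) = ennreal s"
    using round_sphere_volume_finite[OF n] by (cases "round_sphere_volume TYPE('n)") auto
  \<comment> \<open>Every positive V occurs, so any real number above the volume of the sphere can
    be taken as \<open>Vm\<close>.\<close>
  show ?thesis
    using sol s by (intro exI[of _ "s + 1"]) (auto simp: ennreal_less_iff)
qed

end
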